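(* Fix $q\in\mathbb{R}_+$ and $\gamma\in\mathbb{R}$, $\gamma\ne-1$. Let $(Q_qf)(t)=t^{-1/q}\int_t^{\infty}f(s)s^{\frac1q-1}\,ds$, $t\in\mathbb{R}_+$. Suppose that $\Phi_1(t)=\int_0^t\phi_1(s)\,ds$ and $\Phi_2(t)=\int_0^t\phi_2(s)\,ds$ are Young functions having complementary functions $\Psi_1$ and $\Psi_2$, respectively. Then the following are equivalent: (G) there is $L>0$, independent of $f$, such that $\rho^{(1)}_{\Phi_1,t^{\gamma}}(Q_qf)\le L\,\rho^{(1)}_{\Phi_2,t^{\gamma}}(f)$ for all $0\le f\in M(\mathbb{R}_+)$; (M) there is $K>0$, independent of $f$, such that $$\int_{\mathbb{R}_+}\Phi_1\big(|(Q_qf)(t)|\big)t^{\gamma}\,dt\le\int_{\mathbb{R}_+}\Phi_2\big(K|f(s)|\big)s^{\gamma}\,ds\qquad\text{for all }0\le f\in M(\mathbb{R}_+);$$ (I) $Q_q:L_{\Phi_2,t^{\gamma}}(\mathbb{R}_+)\to L_{\Phi_1,t^{\gamma}}(\mathbb{R}_+)$, this mapping being continuous with respect to the norms $\rho^{(1)}_{\Phi_2,t^\gamma}$ and $\rho^{(1)}_{\Phi_1,t^\gamma}$; (BK) there is $C>0$, independent of $t$, such that for all $t\in\mathbb{R}_+$ $$\int_0^t\Phi_1\Big(\frac{\beta(t)}{C\,s^{1/q}}\Big)s^{\gamma}\,ds\le\beta(t)=\int_t^{\infty}\Psi_2\big(s^{\frac1q-1-\gamma}\big)s^{\gamma}\,ds<\infty,$$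 or, equivalently, there is $C>0$, independent of $t$, such that for all $t\in\mathbb{R}_+$, with the same $\beta(t)<\infty$, $$\int_0^t\phi_1\Big(\frac{\beta(t)}{C\,s^{1/q}}\Big)s^{\gamma-\frac1q}\,ds\le C.$$
   Context: $\mathbb{R}_+=(0,\infty)$; $M(\mathbb{R}_+)$ is the class of Lebesgue-measurable functions on $\mathbb{R}_+$. A Young function is a function $\Phi(t)=\int_0^t\phi(s)\,ds$, $t\in\mathbb{R}_+$ (with $\Phi(0)=0$), where $\phi$ is nonnegative and nondecreasing on $\mathbb{R}_+$ with $\phi(0^+)=0$ and $\lim_{s\to\infty}\phi(s)=\infty$. Its complementary function is $\Psi(t)=\int_0^t\phi^{-1}(s)\,ds$, where $\phi^{-1}$ is the inverse of $\phi$ (the generalized inverse $\phi^{-1}(s)=\sup\{r>0:\phi(r)\le s\}$ if $\phi$ is not a bijection). The Orlicz class is $$L_{\Phi,t^{\gamma}}(\mathbb{R}_+)=\Big\{f\in M(\mathbb{R}_+):\int_{\mathbb{R}_+}\Phi(k|f(t)|)t^{\gamma}dt<\infty\text{ for some }k\in\mathbb{R}_+\Big\},$$ and $$\rho^{(1)}_{\Phi,t^{\gamma}}(f)=\inf\Big\{\lambda>0:\int_{\mathbb{R}_+}\Phi\Big(\frac{|f(t)|}{\lambda}\Big)t^{\gamma}\,dt\le1\Big\}.$$ *)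

theory Defs
  imports "HOL-Analysis.Analysis"
begin

text \<open>
  The half line is \<open>{0<..}\<close>; values of functions outside it never matter.
  Quantities that may be infinite (modulars, gauges, \<open>Q f\<close> for nonnegative \<open>f\<close>) are
  \<^typ>\<open>ennreal\<close>-valued.
\<close>

definition young_density :: "(real \<Rightarrow> real) \<Rightarrow> bool" where
  "young_density \<phi> \<longleftrightarrow>
     (\<forall>s>0. 0 \<le> \<phi> s) \<and> mono_on {0<..} \<phi> \<and>
     (\<phi> \<longlongrightarrow> 0) (at_right 0) \<and> filterlim \<phi> at_top at_top"

text \<open>
  \<open>young \<phi> t = \<integral>\<^sub>0\<^sup>t \<phi>(s) ds\<close>. The argument is extended so that the function can be
  applied to \<open>Q f\<close> where that is infinite: then the integral is over all of \<open>{0<..}\<close>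
  and equals \<open>\<infinity>\<close>.
\<close>

definition young :: "(real \<Rightarrow> real) \<Rightarrow> ennreal \<Rightarrow> ennreal" where
  "young \<phi> t = (\<integral>\<^sup>+ s \<in> {s. 0 < s \<and> ennreal s < t}. ennreal (\<phi> s) \<partial>lborel)"

text \<open>
  For a Young density the set below is nonempty and bounded for every \<open>s > 0\<close>, and when
  \<open>\<phi>\<close> is a bijection of \<open>{0<..}\<close> the supremum is the ordinary inverse.
\<close>

definition gen_inverse :: "(real \<Rightarrow> real) \<Rightarrow> real \<Rightarrow> real" where
  "gen_inverse \<phi> s = Sup {r. 0 < r \<and> \<phi> r \<le> s}"

definition complementary :: "(real \<Rightarrow> real) \<Rightarrow> ennreal \<Rightarrow> ennreal" where
  "complementary \<phi> = young (gen_inverse \<phi>)"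

definition half_line_measurable :: "(real \<Rightarrow> real) set" where
  "half_line_measurable = borel_measurable (lebesgue_on {0<..})"

definition modular :: "(ennreal \<Rightarrow> ennreal) \<Rightarrow> real \<Rightarrow> (real \<Rightarrow> ennreal) \<Rightarrow> ennreal" where
  "modular \<Phi> \<gamma> F = (\<integral>\<^sup>+ t \<in> {0<..}. \<Phi> (F t) * ennreal (t powr \<gamma>) \<partial>lebesgue)"

text \<open>The functions \<open>F\<close> here stand for \<open>\<bar>f\<bar>\<close>; the infimum of the empty set is \<open>\<infinity>\<close>.\<close>

definition gauge_norm :: "(ennreal \<Rightarrow> ennreal) \<Rightarrow> real \<Rightarrow> (real \<Rightarrow> ennreal) \<Rightarrow> ennreal" where
  "gauge_norm \<Phi> \<gamma> F =
     Inf {ennreal l | l. 0 < l \<and> modular \<Phi> \<gamma> (\<lambda>t. F t / ennreal l) \<le> 1}"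

definition orlicz_class :: "(ennreal \<Rightarrow> ennreal) \<Rightarrow> real \<Rightarrow> (real \<Rightarrow> real) set" where
  "orlicz_class \<Phi> \<gamma> =
     {f \<in> half_line_measurable. \<exists>k>0. modular \<Phi> \<gamma> (\<lambda>t. ennreal (k * \<bar>f t\<bar>)) < \<infinity>}"

text \<open>
  Two versions of \<open>Q\<close>: for nonnegative functions, where the integral always exists
  but may be infinite, and for real functions, meaningful when \<open>hardy_defined\<close> holds.
\<close>

definition hardy_nonneg :: "real \<Rightarrow> (real \<Rightarrow> ennreal) \<Rightarrow> real \<Rightarrow> ennreal" where
  "hardy_nonneg q F t =
     ennreal (t powr (- (1 / q))) *
     (\<integral>\<^sup>+ s \<in> {t<..}. F s * ennreal (s powr (1 / q - 1)) \<partial>lebesgue)"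

definition hardy_defined :: "real \<Rightarrow> (real \<Rightarrow> real) \<Rightarrow> bool" where
  "hardy_defined q f \<longleftrightarrow>
     (\<forall>t>0. set_integrable lebesgue {t<..} (\<lambda>s. f s * s powr (1 / q - 1)))"

definition hardy_Q :: "real \<Rightarrow> (real \<Rightarrow> real) \<Rightarrow> real \<Rightarrow> real" where
  "hardy_Q q f t = t powr (- (1 / q)) * (LINT s:{t<..}|lebesgue. f s * s powr (1 / q - 1))"

lemma hardy_nonneg_eq:
  assumes "hardy_defined q f" "\<And>s. 0 < s \<Longrightarrow> 0 \<le> f s" "0 < t"
  shows "hardy_nonneg q (\<lambda>s. ennreal (f s)) t = ennreal (hardy_Q q f t)"
proof -
  let ?g = "\<lambda>s. indicator {t<..} s * (f s * s powr (1 / q - 1))"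
  have int: "integrable lebesgue ?g"
    using assms by (auto simp: hardy_defined_def set_integrable_def)
  have nonneg: "0 \<le> ?g s" for s
    using assms by (auto simp: indicator_def)
  have "(\<integral>\<^sup>+ s \<in> {t<..}. ennreal (f s) * ennreal (s powr (1 / q - 1)) \<partial>lebesgue)
      = (\<integral>\<^sup>+ s. ennreal (?g s) \<partial>lebesgue)"
    using assms by (intro nn_integral_cong) (auto simp: indicator_def ennreal_mult)
  also have "\<dots> = ennreal (integral\<^sup>L lebesgue ?g)"
    using int nonneg by (intro nn_integral_eq_integral) auto
  finally show ?thesis
    by (simp add: hardy_nonneg_def hardy_Q_def set_lebesgue_integral_def ennreal_mult')
qed

definition orlicz_continuous ::
    "(ennreal \<Rightarrow> ennreal) \<Rightarrow> (ennreal \<Rightarrow> ennreal) \<Rightarrow> real \<Rightarrow> ((real \<Rightarrow> real) \<Rightarrow> real \<Rightarrow> real) \<Rightarrow> bool" where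
  "orlicz_continuous \<Phi>2 \<Phi>1 \<gamma> T \<longleftrightarrow>
     (\<forall>f\<in>orlicz_class \<Phi>2 \<gamma>. \<forall>\<epsilon>>0. \<exists>\<delta>>0. \<forall>g\<in>orlicz_class \<Phi>2 \<gamma>.
        gauge_norm \<Phi>2 \<gamma> (\<lambda>t. ennreal \<bar>g t - f t\<bar>) < ennreal \<delta> \<longrightarrow>
        gauge_norm \<Phi>1 \<gamma> (\<lambda>t. ennreal \<bar>T g t - T f t\<bar>) < ennreal \<epsilon>)"

definition hardy_beta :: "real \<Rightarrow> real \<Rightarrow> (ennreal \<Rightarrow> ennreal) \<Rightarrow> real \<Rightarrow> ennreal" where
  "hardy_beta q \<gamma> \<Psi>2 t =
     (\<integral>\<^sup>+ s \<in> {t<..}. \<Psi>2 (ennreal (s powr (1 / q - 1 - \<gamma>))) * ennreal (s powr \<gamma>) \<partial>lebesgue)"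

end

theory Submission
  imports Defs
begin

text \<open>
  Write \<open>a = 1/q\<close> and \<open>b = a - 1 - \<gamma>\<close>, so that \<open>s\<^sup>a\<^sup>-\<^sup>1 = s\<^sup>b s\<^sup>\<gamma>\<close>.

  Everything rests on homogeneity. The operator commutes with dilations, and the dilation by \<open>c\<close>
  divides modulars by \<open>c\<^sup>\<gamma>\<^sup>+\<^sup>1\<close>, which takes all positive values because \<open>\<gamma> \<noteq> -1\<close>. Hence a
  norm inequality, which speaks about unit balls, already gives the inequality between the modulars
  themselves (\<open>modular_bound_of_gauge_bound\<close>), and the converse is immediate. The norm inequality and
  continuity are equivalent since the operator is linear and \<open>\<bar>Q f\<bar> \<le> Q \<bar>f\<bar>\<close>.

  The modular inequality implies the weak condition by testing it on \<open>f = \<Psi>\<^sub>2(u)/(K u)\<close> on \<open>(t, \<infinity>)\<close>,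
  with \<open>u(s) = s\<^sup>b\<close>, because \<open>\<Phi>\<^sub>2(\<Psi>\<^sub>2(x)/x) \<le> \<Psi>\<^sub>2(x)\<close> (\<open>weak_bound_on_set\<close>). That \<open>\<beta>(t)\<close> is finite
  comes from the superlinear growth of \<open>\<Phi>\<^sub>1\<close> (\<open>hardy_beta_finite\<close>).

  Conversely, dilations turn the weak condition at all points \<open>t\<close> into the stronger statement in which
  \<open>\<Psi>\<^sub>2(s\<^sup>b)\<close> is replaced by \<open>\<Psi>\<^sub>2(\<epsilon> s\<^sup>b)\<close> with arbitrary \<open>\<epsilon> > 0\<close> (\<open>weak_bound_scaled\<close>); this uses \<open>b \<noteq> 0\<close>,
  which finiteness of \<open>\<beta>\<close> guarantees. Cut the half-line into the sets where the tail integral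
  \<open>F(x) = \<integral>\<^sub>x\<^sup>\<infinity> f s\<^sup>a\<^sup>-\<^sup>1 ds\<close> lies between consecutive powers of \<open>2\<close>. On the level \<open>k\<close>, \<open>F\<close> is at most
  four times the integral of \<open>f s\<^sup>a\<^sup>-\<^sup>1\<close> over a part of the next level \<open>k - 1\<close>, and Young's inequality with
  \<open>\<epsilon>\<close> adapted to this part bounds the modular of \<open>Q f\<close> on the level \<open>k\<close> by that of \<open>8 C f\<close> on the level
  \<open>k - 1\<close> (\<open>modular_bound_on_piece\<close>, \<open>modular_bound_on_level\<close>). The levels are disjoint, so the
  estimates add up.

  The two forms of the weak condition agree because \<open>\<Phi>\<^sub>1(y) \<le> y \<phi>\<^sub>1(y) \<le> \<Phi>\<^sub>1(2y)\<close>.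
\<close>

section \<open>Young functions\<close>

lemma young_mono: "x \<le> y \<Longrightarrow> young \<phi> x \<le> young \<phi> y"
  unfolding young_def
  by (intro nn_integral_mono) (auto simp: indicator_def intro: order.strict_trans2)

lemma young_zero [simp]: "young \<phi> 0 = 0"
  by (simp add: young_def)

lemma young_ennreal:
  "young \<phi> (ennreal x) = (\<integral>\<^sup>+ s \<in> {0<..<x}. ennreal (\<phi> s) \<partial>lborel)"
  unfolding young_def
  by (intro nn_integral_cong) (auto simp: indicator_def ennreal_less_iff)

lemma mono_on_half_line_measurable:
  fixes \<phi> :: "real \<Rightarrow> real"
  assumes "mono_on {0<..} \<phi>"
  shows "(\<lambda>s. indicator {0<..} s * \<phi> s) \<in> borel_measurable borel"
  using borel_measurable_mono_on_fnc[OF assms]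
  by (subst (asm) borel_measurable_restrict_space_iff) auto

lemma young_le_mult:
  assumes "mono_on {0<..} \<phi>" "0 < x"
  shows "young \<phi> (ennreal x) \<le> ennreal (x * \<phi> x)"
proof -
  have "young \<phi> (ennreal x) \<le> (\<integral>\<^sup>+ s. ennreal (\<phi> x) * indicator {0<..<x} s \<partial>lborel)"
    unfolding young_ennreal using assms
    by (intro nn_integral_mono) (auto simp: indicator_def mono_on_def intro!: ennreal_leI)
  also have "\<dots> = ennreal (x * \<phi> x)"
    using assms by (simp add: nn_integral_cmult_indicator ennreal_mult' mult.commute)
  finally show ?thesis .
qed

lemma mult_le_young:
  assumes "mono_on {0<..} \<phi>" "0 < x" "x \<le> y"
  shows "ennreal ((y - x) * \<phi> x) \<le> young \<phi> (ennreal y)"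
proof -
  have "ennreal ((y - x) * \<phi> x) = (\<integral>\<^sup>+ s. ennreal (\<phi> x) * indicator {x<..<y} s \<partial>lborel)"
    using assms
    by (simp add: nn_integral_cmult_indicator ennreal_mult'' flip: mult.commute[of "\<phi> x"])
  also have "\<dots> \<le> young \<phi> (ennreal y)"
    unfolding young_ennreal using assms
    by (intro nn_integral_mono) (auto simp: indicator_def mono_on_def intro!: ennreal_leI)
  finally show ?thesis .
qed

lemma young_finite:
  assumes "mono_on {0<..} \<phi>"
  shows "young \<phi> (ennreal x) < \<infinity>"
proof (cases "0 < x")
  case True
  then show ?thesis using young_le_mult[OF assms True] by (auto intro: le_less_trans)
next
  case False
  then show ?thesis by (simp add: ennreal_neg)
qed

text \<open>This is convexity together with \<open>\<Phi>(0) = 0\<close>; directly, substitute \<open>s = cr\<close> and use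
  \<open>\<phi>(cr) \<le> \<phi>(r)\<close>.\<close>
lemma young_scale:
  assumes mono: "mono_on {0<..} \<phi>" and c: "0 < c" "c \<le> 1"
  shows "young \<phi> (ennreal (c * x)) \<le> ennreal c * young \<phi> (ennreal x)"
proof -
  note [measurable] = mono_on_half_line_measurable[OF mono]
  have eq: "young \<phi> (ennreal y)
      = (\<integral>\<^sup>+ s. ennreal (indicator {0<..} s * \<phi> s) * indicator {0<..<y} s \<partial>lborel)" for y
    unfolding young_ennreal by (intro nn_integral_cong) (auto simp: indicator_def)
  have "young \<phi> (ennreal (c * x)) = ennreal \<bar>c\<bar> *
     (\<integral>\<^sup>+ r. ennreal (indicator {0<..} (0 + c * r) * \<phi> (0 + c * r)) * indicator {0<..<c * x} (0 + c * r) \<partial>lborel)"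
    unfolding eq using c by (intro nn_integral_real_affine) auto
  also have "\<dots> \<le> ennreal c * (\<integral>\<^sup>+ s. ennreal (indicator {0<..} s * \<phi> s) * indicator {0<..<x} s \<partial>lborel)"
  proof -
    have "c * r \<le> r" if "0 < r" for r using that c by (simp add: mult_left_le_one_le)
    then show ?thesis
    using c mono
    by (auto simp: indicator_def mono_on_def zero_less_mult_iff
        intro!: mult_left_mono nn_integral_mono ennreal_leI)
  qed
  finally show ?thesis unfolding eq .
qed

text \<open>As \<open>\<phi>\<close> is unbounded, there is \<open>s\<close> with \<open>\<phi>(s) \<ge> 2m\<close>; then \<open>\<Phi>(y) \<ge> (y - s) \<phi>(s) \<ge> m y\<close> for
  \<open>y \<ge> 2s\<close>.\<close>
lemma young_density_superlinear:
  assumes "young_density \<phi>" "0 \<le> m"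
  obtains y0 where "0 < y0" "\<And>y. y0 \<le> y \<Longrightarrow> ennreal (m * y) \<le> young \<phi> (ennreal y)"
proof -
  have mono: "mono_on {0<..} \<phi>" and lim: "filterlim \<phi> at_top at_top"
    using assms by (auto simp: young_density_def)
  have "eventually (\<lambda>s. 2 * m \<le> \<phi> s) at_top"
    using lim by (simp add: filterlim_at_top)
  then obtain s1 where s1: "\<And>s. s1 \<le> s \<Longrightarrow> 2 * m \<le> \<phi> s"
    by (auto simp: eventually_at_top_linorder)
  define s where "s = max s1 1"
  have s: "0 < s" "2 * m \<le> \<phi> s" using s1 by (auto simp: s_def)
  have "ennreal (m * y) \<le> young \<phi> (ennreal y)" if y: "2 * s \<le> y" for y
  proof -
    have "m * y \<le> (y - s) * (2 * m)"
      using mult_right_mono[OF y, of m] \<open>0 \<le> m\<close> by (simp add: algebra_simps)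
    also have "\<dots> \<le> (y - s) * \<phi> s" using s y by (intro mult_left_mono) auto
    finally show ?thesis
      using mult_le_young[OF mono, of s y] s y by (auto intro: order_trans ennreal_leI)
  qed
  then show ?thesis using that[of "2 * s"] s by auto
qed

lemma young_top:
  assumes "young_density \<phi>"
  shows "young \<phi> top = top"
proof -
  obtain y0 where y0: "0 < y0" "\<And>y. y0 \<le> y \<Longrightarrow> ennreal (1 * y) \<le> young \<phi> (ennreal y)"
    using young_density_superlinear[OF assms, of 1] by auto
  have "ennreal z \<le> young \<phi> top" for z
  proof -
    have "ennreal z \<le> ennreal (1 * max z y0)" by (auto intro: ennreal_leI)
    also have "\<dots> \<le> young \<phi> (ennreal (max z y0))" by (intro y0) auto
    also have "\<dots> \<le> young \<phi> top" by (intro young_mono) auto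
    finally show ?thesis .
  qed
  from this[of "enn2real (young \<phi> top) + 1"] show ?thesis
    by (cases "young \<phi> top") auto
qed

section \<open>Complementary functions\<close>

lemma gen_inverse_set:
  assumes "young_density \<phi>" "0 < s"
  shows "{r. 0 < r \<and> \<phi> r \<le> s} \<noteq> {}" "bdd_above {r. 0 < r \<and> \<phi> r \<le> s}"
proof -
  have "eventually (\<lambda>r. \<phi> r < s) (at_right 0)"
    using assms by (auto simp: young_density_def intro: order_tendstoD)
  then obtain d where "0 < d" "\<And>r. 0 < r \<Longrightarrow> r < d \<Longrightarrow> \<phi> r < s"
    by (auto simp: eventually_at_right_field)
  from this(1) this(2)[of "d / 2"] have "0 < d / 2" "\<phi> (d / 2) \<le> s" by auto
  then show "{r. 0 < r \<and> \<phi> r \<le> s} \<noteq> {}" by blast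
  have "eventually (\<lambda>r. s + 1 \<le> \<phi> r) at_top"
    using assms by (simp add: young_density_def filterlim_at_top)
  then obtain R where R: "\<And>r. R \<le> r \<Longrightarrow> s + 1 \<le> \<phi> r"
    by (auto simp: eventually_at_top_linorder)
  have "r \<le> R" if "\<phi> r \<le> s" for r
    using R[of r] that by linarith
  then show "bdd_above {r. 0 < r \<and> \<phi> r \<le> s}"
    by (intro bdd_aboveI[of _ R]) auto
qed

lemma le_gen_inverse:
  assumes "young_density \<phi>" "0 < s" "0 < r" "\<phi> r \<le> s"
  shows "r \<le> gen_inverse \<phi> s"
  unfolding gen_inverse_def using assms gen_inverse_set[OF assms(1,2)] by (intro cSup_upper) auto

lemma gen_inverse_pos: "young_density \<phi> \<Longrightarrow> 0 < s \<Longrightarrow> 0 < gen_inverse \<phi> s"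
  using gen_inverse_set(1)[of \<phi> s] le_gen_inverse[of \<phi> s] by fastforce

lemma less_gen_inverse:
  assumes "young_density \<phi>" "0 < s" "0 < r" "r < gen_inverse \<phi> s"
  shows "\<phi> r \<le> s"
proof -
  obtain r' where "0 < r'" "\<phi> r' \<le> s" "r < r'"
    using less_cSupD[OF gen_inverse_set(1)[OF assms(1,2)] assms(4)[unfolded gen_inverse_def]] by auto
  moreover have "\<phi> r \<le> \<phi> r'"
    using assms \<open>r < r'\<close> by (auto simp: young_density_def mono_on_def)
  ultimately show ?thesis by simp
qed

lemma mono_gen_inverse:
  assumes "young_density \<phi>"
  shows "mono_on {0<..} (gen_inverse \<phi>)"
proof (rule mono_onI)
  fix s s' :: real assume "s \<in> {0<..}" "s' \<in> {0<..}" "s \<le> s'"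
  then show "gen_inverse \<phi> s \<le> gen_inverse \<phi> s'"
    unfolding gen_inverse_def using gen_inverse_set[OF assms, of s] gen_inverse_set[OF assms, of s']
    by (intro cSup_subset_mono) auto
qed

lemma complementary_pos:
  assumes "young_density \<phi>" "0 < x"
  shows "0 < complementary \<phi> (ennreal x)"
proof -
  have "0 < ennreal ((x - x / 2) * gen_inverse \<phi> (x / 2))"
    using assms gen_inverse_pos[OF assms(1), of "x / 2"] by simp
  also have "\<dots> \<le> complementary \<phi> (ennreal x)"
    unfolding complementary_def using assms by (intro mult_le_young mono_gen_inverse) auto
  finally show ?thesis .
qed

text \<open>The area argument: a point \<open>(r, s)\<close> of the rectangle \<open>(0,x) \<times> (0,y)\<close> lies below the graph
  of \<open>\<phi>\<close> or satisfies \<open>r \<le> \<phi>\<^sup>-\<^sup>1(s)\<close>. The first region over \<open>0 < r < x\<close> has area \<open>\<Phi>(x)\<close>, the second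
  over \<open>0 < s < y\<close> has area \<open>\<Psi>(y)\<close>.\<close>
lemma young_inequality:
  assumes yd: "young_density \<phi>" and "0 \<le> x" "0 \<le> y"
  shows "ennreal (x * y) \<le> young \<phi> (ennreal x) + complementary \<phi> (ennreal y)"
proof -
  let ?Y = "gen_inverse \<phi>"
  have mono: "mono_on {0<..} \<phi>" and nn: "\<And>s. 0 < s \<Longrightarrow> 0 \<le> \<phi> s"
    using yd by (auto simp: young_density_def)
  have monoY: "mono_on {0<..} ?Y" by (rule mono_gen_inverse[OF yd])
  define p where "p = (\<lambda>s. indicator {0<..} s * \<phi> s)"
  define P where "P = (\<lambda>s. indicator {0<..} s * ?Y s)"
  have [measurable]: "p \<in> borel_measurable borel" "P \<in> borel_measurable borel"
    unfolding p_def P_def by (auto intro: mono_on_half_line_measurable mono monoY)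
  define a :: "real \<Rightarrow> real \<Rightarrow> ennreal"
    where "a r s = indicator {0<..<x} r * (if 0 < s \<and> s < p r then 1 else 0)" for r s
  define d :: "real \<Rightarrow> real \<Rightarrow> ennreal"
    where "d r s = indicator {0<..<y} s * (if 0 < r \<and> r \<le> P s then 1 else 0)" for r s
  have [measurable]: "case_prod a \<in> borel_measurable (lborel \<Otimes>\<^sub>M lborel)"
    "case_prod d \<in> borel_measurable (lborel \<Otimes>\<^sub>M lborel)"
    unfolding a_def d_def by measurable
  have "ennreal (x * y) = (\<integral>\<^sup>+ r. ennreal y * indicator {0<..<x} r \<partial>lborel)"
    using assms by (simp add: nn_integral_cmult_indicator ennreal_mult' mult.commute)
  also have "\<dots> = (\<integral>\<^sup>+ r. (\<integral>\<^sup>+ s. indicator {0<..<x} r * indicator {0<..<y} s \<partial>lborel) \<partial>lborel)"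
    using assms by (simp add: nn_integral_cmult mult.commute)
  also have "\<dots> \<le> (\<integral>\<^sup>+ r. (\<integral>\<^sup>+ s. a r s + d r s \<partial>lborel) \<partial>lborel)"
  proof (intro nn_integral_mono)
    fix r s :: real
    show "indicator {0<..<x} r * indicator {0<..<y} s \<le> a r s + d r s"
      using le_gen_inverse[OF yd, of s r]
      by (auto simp: a_def d_def indicator_def p_def P_def not_less)
  qed
  also have "\<dots> = (\<integral>\<^sup>+ r. (\<integral>\<^sup>+ s. a r s \<partial>lborel) + (\<integral>\<^sup>+ s. d r s \<partial>lborel) \<partial>lborel)"
    by (subst nn_integral_add) auto
  also have "\<dots> = (\<integral>\<^sup>+ r. (\<integral>\<^sup>+ s. a r s \<partial>lborel) \<partial>lborel) + (\<integral>\<^sup>+ r. (\<integral>\<^sup>+ s. d r s \<partial>lborel) \<partial>lborel)"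
    by (subst nn_integral_add) auto
  also have "(\<integral>\<^sup>+ r. (\<integral>\<^sup>+ s. d r s \<partial>lborel) \<partial>lborel) = (\<integral>\<^sup>+ s. (\<integral>\<^sup>+ r. d r s \<partial>lborel) \<partial>lborel)"
    by (rule lborel_pair.Fubini') simp
  also have "(\<integral>\<^sup>+ r. (\<integral>\<^sup>+ s. a r s \<partial>lborel) \<partial>lborel) = young \<phi> (ennreal x)"
    unfolding young_ennreal
  proof (intro nn_integral_cong)
    fix r :: real
    have "(\<integral>\<^sup>+ s. a r s \<partial>lborel) = (\<integral>\<^sup>+ s. indicator {0<..<x} r * indicator {0<..<p r} s \<partial>lborel)"
      by (intro nn_integral_cong) (auto simp: a_def indicator_def)
    also have "\<dots> = indicator {0<..<x} r * emeasure lborel {0<..<p r}"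
      by (simp add: nn_integral_cmult)
    also have "\<dots> = ennreal (\<phi> r) * indicator {0<..<x} r"
      using nn[of r] by (auto simp: indicator_def p_def)
    finally show "(\<integral>\<^sup>+ s. a r s \<partial>lborel) = ennreal (\<phi> r) * indicator {0<..<x} r" .
  qed
  also have "(\<integral>\<^sup>+ s. (\<integral>\<^sup>+ r. d r s \<partial>lborel) \<partial>lborel) = complementary \<phi> (ennreal y)"
    unfolding complementary_def young_ennreal
  proof (intro nn_integral_cong)
    fix s :: real
    have "(\<integral>\<^sup>+ r. d r s \<partial>lborel) = (\<integral>\<^sup>+ r. indicator {0<..<y} s * indicator {0<..P s} r \<partial>lborel)"
      by (intro nn_integral_cong) (auto simp: d_def indicator_def)
    also have "\<dots> = indicator {0<..<y} s * emeasure lborel {0<..P s}"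
      by (simp add: nn_integral_cmult)
    also have "\<dots> = ennreal (?Y s) * indicator {0<..<y} s"
      using gen_inverse_pos[OF yd, of s] by (auto simp: indicator_def P_def)
    finally show "(\<integral>\<^sup>+ r. d r s \<partial>lborel) = ennreal (?Y s) * indicator {0<..<y} s" .
  qed
  finally show ?thesis .
qed

text \<open>The quotient \<open>z = \<Psi>(x)/x\<close> is an average of \<open>\<phi>\<^sup>-\<^sup>1\<close> over \<open>(0,x)\<close>, so \<open>z \<le> \<phi>\<^sup>-\<^sup>1(x)\<close> and
  \<open>\<phi> \<le> x\<close> on \<open>(0,z)\<close>.\<close>
lemma young_complementary_quotient_le:
  assumes yd: "young_density \<phi>" and "0 < x"
  shows "young \<phi> (ennreal (enn2real (complementary \<phi> (ennreal x)) / x)) \<le> complementary \<phi> (ennreal x)"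
proof -
  define z where "z = enn2real (complementary \<phi> (ennreal x)) / x"
  have fin: "complementary \<phi> (ennreal x) < \<infinity>"
    unfolding complementary_def by (intro young_finite mono_gen_inverse yd)
  have eq: "complementary \<phi> (ennreal x) = ennreal (x * z)"
    using fin \<open>0 < x\<close> by (simp add: z_def)
  have "ennreal (x * z) \<le> ennreal (x * gen_inverse \<phi> x)"
    unfolding eq[symmetric] unfolding complementary_def
    by (intro young_le_mult mono_gen_inverse yd \<open>0 < x\<close>)
  then have "x * z \<le> x * gen_inverse \<phi> x"
    using \<open>0 < x\<close> gen_inverse_pos[OF yd \<open>0 < x\<close>] by (simp add: ennreal_le_iff)
  then have z: "z \<le> gen_inverse \<phi> x"
    using \<open>0 < x\<close> by (rule mult_left_le_imp_le)
  have "0 \<le> z" using \<open>0 < x\<close> by (simp add: z_def)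
  have "young \<phi> (ennreal z) \<le> (\<integral>\<^sup>+ s. ennreal x * indicator {0<..<z} s \<partial>lborel)"
    unfolding young_ennreal using less_gen_inverse[OF yd \<open>0 < x\<close>] z \<open>0 \<le> z\<close>
    by (intro nn_integral_mono) (auto simp: indicator_def intro!: ennreal_leI)
  also have "\<dots> = ennreal (x * z)"
    using \<open>0 \<le> z\<close> \<open>0 < x\<close> by (simp add: nn_integral_cmult_indicator ennreal_mult')
  finally have "young \<phi> (ennreal z) \<le> complementary \<phi> (ennreal x)"
    by (simp only: eq)
  then show ?thesis by (simp only: z_def)
qed

section \<open>Tail integrals and dilations\<close>

lemma borel_imp_lebesgue_measurable: "f \<in> borel_measurable borel \<Longrightarrow> f \<in> borel_measurable lebesgue"
  by (rule measurable_completion) simp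

lemma interval_lebesgue_sets [measurable, simp]:
  fixes a b :: real
  shows "{a<..} \<in> sets lebesgue" "{a<..<b} \<in> sets lebesgue" "{a<..b} \<in> sets lebesgue"
  by (auto intro!: sets_completionI_sets)

lemma powr_lebesgue_measurable [measurable]: "(\<lambda>s::real. ennreal (s powr r)) \<in> borel_measurable lebesgue"
  by (rule borel_imp_lebesgue_measurable) simp

definition tail_integral :: "(real \<Rightarrow> ennreal) \<Rightarrow> real \<Rightarrow> ennreal" where
  "tail_integral h t = (\<integral>\<^sup>+ s \<in> {t<..}. h s \<partial>lebesgue)"

lemma tail_integral_antimono: "t \<le> t' \<Longrightarrow> tail_integral h t' \<le> tail_integral h t"
  unfolding tail_integral_def by (intro nn_integral_mono) (auto simp: indicator_def)

lemma tail_integral_split: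
  assumes [measurable]: "h \<in> borel_measurable lebesgue" and "t \<le> t'"
  shows "tail_integral h t = (\<integral>\<^sup>+ s \<in> {t<..<t'}. h s \<partial>lebesgue) + tail_integral h t'"
proof -
  have "AE s in lebesgue. s \<noteq> t'"
    by (rule AE_completion) (rule AE_lborel_singleton)
  then have "tail_integral h t
      = (\<integral>\<^sup>+ s. h s * indicator {t<..<t'} s + h s * indicator {t'<..} s \<partial>lebesgue)"
    unfolding tail_integral_def
    by (intro nn_integral_cong_AE, eventually_elim) (use \<open>t \<le> t'\<close> in \<open>auto simp: indicator_def\<close>)
  also have "\<dots> = (\<integral>\<^sup>+ s \<in> {t<..<t'}. h s \<partial>lebesgue) + tail_integral h t'"
    unfolding tail_integral_def by (rule nn_integral_add) auto
  finally show ?thesis .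
qed

text \<open>The sets where a monotone function exceeds a level are half-lines, open or closed at the end
  point, unless they are empty or everything.\<close>
lemma antimono_borel_measurable_ennreal:
  fixes f :: "real \<Rightarrow> ennreal"
  assumes "antimono f"
  shows "f \<in> borel_measurable borel"
proof (rule borel_measurableI_greater)
  fix y
  define S where "S = {x. y < f x}"
  have down: "x' \<in> S" if "x \<in> S" "x' \<le> x" for x x'
    using that antimonoD[OF assms \<open>x' \<le> x\<close>] by (auto simp: S_def)
  have "S \<in> sets borel"
  proof (cases "S = {} \<or> S = UNIV")
    case False
    then obtain z where "z \<notin> S" by auto
    then have bdd: "bdd_above S" using down by (intro bdd_aboveI[of _ z]) (meson linear)
    have "{..<Sup S} \<subseteq> S"
    proof
      fix x assume "x \<in> {..<Sup S}"
      then obtain x' where "x' \<in> S" "x < x'" using less_cSupD[of S x] False by auto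
      then show "x \<in> S" using down by (meson less_imp_le)
    qed
    moreover have "S \<subseteq> {..Sup S}" using bdd by (auto intro: cSup_upper)
    ultimately have "S = {..<Sup S} \<or> S = {..Sup S}"
      by (cases "Sup S \<in> S") (auto simp: order.order_iff_strict)
    then show ?thesis by (elim disjE) (erule ssubst, simp)+
  qed auto
  then show "{x \<in> space borel. y < f x} \<in> sets borel" by (simp add: S_def)
qed

lemma mono_borel_measurable_ennreal:
  fixes f :: "ennreal \<Rightarrow> ennreal"
  assumes "mono f"
  shows "f \<in> borel_measurable borel"
proof (rule borel_measurableI_greater)
  fix y
  define S where "S = {x. y < f x}"
  have up: "x' \<in> S" if "x \<in> S" "x \<le> x'" for x x'
    using that monoD[OF assms \<open>x \<le> x'\<close>] by (auto simp: S_def)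
  have "{Inf S<..} \<subseteq> S"
    using up by (auto simp: Inf_less_iff less_imp_le)
  moreover have "S \<subseteq> {Inf S..}" by (auto intro: Inf_lower)
  ultimately have "S = {Inf S<..} \<or> S = {Inf S..}"
    by (cases "Inf S \<in> S") (auto simp: order.order_iff_strict)
  then have "S \<in> sets borel" by (elim disjE) (erule ssubst, simp)+
  then show "{x \<in> space borel. y < f x} \<in> sets borel" by (simp add: S_def)
qed

lemma tail_integral_measurable [measurable]: "tail_integral h \<in> borel_measurable borel"
  by (intro antimono_borel_measurable_ennreal antimonoI tail_integral_antimono)

text \<open>Dominated convergence along sequences: the indicators of the rays converge except possibly at
  the limiting end point, a null set.\<close>
lemma continuous_on_tail_integral:
  assumes [measurable]: "h \<in> borel_measurable lebesgue"
    and fin: "\<And>t. 0 < t \<Longrightarrow> tail_integral h t < \<infinity>"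
  shows "continuous_on {0<..} (tail_integral h)"
  unfolding continuous_on_sequentially
proof (intro allI ballI impI)
  fix x :: "nat \<Rightarrow> real" and a :: real
  assume a: "a \<in> {0<..}" and x: "(\<forall>n. x n \<in> {0<..}) \<and> x \<longlonglongrightarrow> a"
  then have "eventually (\<lambda>n. a / 2 < x n) sequentially"
    by (intro order_tendstoD(1)[of _ a]) auto
  then obtain N where N: "\<And>n. N \<le> n \<Longrightarrow> a / 2 < x n"
    by (auto simp: eventually_sequentially)
  have lim: "(\<lambda>n. x (n + N)) \<longlonglongrightarrow> a" using x by (intro LIMSEQ_ignore_initial_segment) auto
  have "AE s in lebesgue. s \<noteq> a"
    by (rule AE_completion) (rule AE_lborel_singleton)
  then have conv: "AE s in lebesgue.
      (\<lambda>n. h s * indicator {x (n + N)<..} s) \<longlonglongrightarrow> h s * indicator {a<..} s"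
  proof eventually_elim
    case (elim s)
    have "eventually (\<lambda>n. indicator {x (n + N)<..} s = (indicator {a<..} s :: ennreal)) sequentially"
    proof (cases "s < a")
      case True
      then show ?thesis using order_tendstoD(1)[OF lim True] by (auto elim!: eventually_mono)
    next
      case False
      then have "a < s" using elim by simp
      show ?thesis using order_tendstoD(2)[OF lim \<open>a < s\<close>] \<open>a < s\<close> by (auto elim!: eventually_mono)
    qed
    then show ?case by (intro tendsto_eventually) (auto elim!: eventually_mono)
  qed
  have "(\<lambda>n. tail_integral h (x (n + N))) \<longlonglongrightarrow> tail_integral h a"
    unfolding tail_integral_def
  proof (rule nn_integral_dominated_convergence[where w = "\<lambda>s. h s * indicator {a / 2<..} s"])
    show "AE s in lebesgue. h s * indicator {x (j + N)<..} s \<le> h s * indicator {a / 2<..} s" for j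
      using N[of "j + N"] by (intro AE_I2) (auto simp: indicator_def)
    show "(\<integral>\<^sup>+ s \<in> {a / 2<..}. h s \<partial>lebesgue) < \<infinity>"
      using fin[of "a / 2"] a by (simp add: tail_integral_def)
  qed (use conv in auto)
  then show "(tail_integral h \<circ> x) \<longlonglongrightarrow> tail_integral h a"
    unfolding o_def by (rule LIMSEQ_offset)
qed

lemma tail_integral_tendsto_0:
  assumes [measurable]: "h \<in> borel_measurable lebesgue" and fin: "tail_integral h t < \<infinity>"
  shows "(\<lambda>n. tail_integral h (t + real n)) \<longlonglongrightarrow> 0"
proof -
  have "(\<lambda>n. tail_integral h (t + real n)) \<longlonglongrightarrow> (\<integral>\<^sup>+ s. 0 \<partial>(lebesgue :: real measure))"
    unfolding tail_integral_def
  proof (rule nn_integral_dominated_convergence[where w = "\<lambda>s. h s * indicator {t<..} s"])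
    show "AE s in lebesgue. h s * indicator {t + real j<..} s \<le> h s * indicator {t<..} s" for j
      by (intro AE_I2) (auto simp: indicator_def)
    show "AE s in lebesgue. (\<lambda>n. h s * indicator {t + real n<..} s) \<longlonglongrightarrow> 0"
    proof (intro AE_I2 tendsto_eventually)
      fix s
      obtain N where "s - t < real N" using reals_Archimedean2 by blast
      then show "eventually (\<lambda>n. h s * indicator {t + real n<..} s = 0) sequentially"
        by (auto simp: eventually_sequentially indicator_def intro!: exI[of _ N])
    qed
    show "(\<integral>\<^sup>+ s \<in> {t<..}. h s \<partial>lebesgue) < \<infinity>"
      using fin by (simp add: tail_integral_def)
  qed auto
  then show ?thesis by simp
qed

lemma lebesgue_measurable_dilation:
  fixes h :: "real \<Rightarrow> 'a::topological_space"
  assumes "h \<in> borel_measurable lebesgue"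
  shows "(\<lambda>x. h (c * x)) \<in> borel_measurable lebesgue"
  using measurable_compose[OF lebesgue_measurable_scaling[of c] assms] by simp

lemma tail_integral_dilation:
  assumes [measurable]: "h \<in> borel_measurable lebesgue" and c: "0 < c" and t: "0 < t"
  shows "tail_integral (\<lambda>s. h s * ennreal (s powr r)) (c * t)
       = ennreal (c powr (r + 1)) * tail_integral (\<lambda>s. h (c * s) * ennreal (s powr r)) t"
proof -
  note [measurable] = lebesgue_measurable_dilation[of h c]
  have inner: "h (0 + c * s) * ennreal ((0 + c * s) powr r) * indicator {c * t<..} (0 + c * s)
      = ennreal (c powr r) * (h (c * s) * ennreal (s powr r) * indicator {t<..} s)" for s
    using c t by (cases "t < s") (simp_all add: powr_mult ennreal_mult' mult_ac)
  have "tail_integral (\<lambda>s. h s * ennreal (s powr r)) (c * t) = ennreal \<bar>c\<bar> *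
    (\<integral>\<^sup>+ s. h (0 + c * s) * ennreal ((0 + c * s) powr r) * indicator {c * t<..} (0 + c * s) \<partial>lebesgue)"
    unfolding tail_integral_def using c by (intro nn_integral_real_affine_lebesgue) auto
  also have "\<dots> = ennreal c * (\<integral>\<^sup>+ s. ennreal (c powr r) *
      (h (c * s) * ennreal (s powr r) * indicator {t<..} s) \<partial>lebesgue)"
    using c by (simp only: inner abs_of_pos)
  also have "\<dots> = ennreal c * (ennreal (c powr r) * tail_integral (\<lambda>s. h (c * s) * ennreal (s powr r)) t)"
    unfolding tail_integral_def by (subst nn_integral_cmult) auto
  also have "\<dots> = ennreal (c powr (r + 1)) * tail_integral (\<lambda>s. h (c * s) * ennreal (s powr r)) t"
    using c by (simp add: powr_add ennreal_mult' mult_ac)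
  finally show ?thesis .
qed

section \<open>Modulars and gauges\<close>

lemma modular_mono:
  assumes "mono \<Phi>" "\<And>t. 0 < t \<Longrightarrow> F t \<le> G t"
  shows "modular \<Phi> \<gamma> F \<le> modular \<Phi> \<gamma> G"
  unfolding modular_def using assms
  by (intro nn_integral_mono) (auto simp: indicator_def intro!: mult_right_mono dest: monoD)

lemma modular_cong: "(\<And>t. 0 < t \<Longrightarrow> F t = G t) \<Longrightarrow> modular \<Phi> \<gamma> F = modular \<Phi> \<gamma> G"
  unfolding modular_def by (intro nn_integral_cong) (auto simp: indicator_def)

lemma modular_dilation:
  assumes "mono \<Phi>" and [measurable]: "F \<in> borel_measurable lebesgue" and c: "0 < c"
  shows "modular \<Phi> \<gamma> F = ennreal (c powr (\<gamma> + 1)) * modular \<Phi> \<gamma> (\<lambda>t. F (c * t))"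
proof -
  note [measurable] = mono_borel_measurable_ennreal[OF \<open>mono \<Phi>\<close>] lebesgue_measurable_dilation[of F c]
  have inner: "\<Phi> (F (0 + c * s)) * ennreal ((0 + c * s) powr \<gamma>) * indicator {0<..} (0 + c * s)
      = ennreal (c powr \<gamma>) * (\<Phi> (F (c * s)) * ennreal (s powr \<gamma>) * indicator {0<..} s)" for s
    using c by (cases "0 < s") (simp_all add: powr_mult ennreal_mult' mult_ac zero_less_mult_iff)
  have "modular \<Phi> \<gamma> F = ennreal \<bar>c\<bar> *
    (\<integral>\<^sup>+ s. \<Phi> (F (0 + c * s)) * ennreal ((0 + c * s) powr \<gamma>) * indicator {0<..} (0 + c * s) \<partial>lebesgue)"
    unfolding modular_def using c by (intro nn_integral_real_affine_lebesgue) auto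
  also have "\<dots> = ennreal c * (\<integral>\<^sup>+ s. ennreal (c powr \<gamma>) *
      (\<Phi> (F (c * s)) * ennreal (s powr \<gamma>) * indicator {0<..} s) \<partial>lebesgue)"
    using c by (simp only: inner abs_of_pos)
  also have "\<dots> = ennreal c * (ennreal (c powr \<gamma>) * modular \<Phi> \<gamma> (\<lambda>t. F (c * t)))"
    unfolding modular_def by (subst nn_integral_cmult) auto
  also have "\<dots> = ennreal (c powr (\<gamma> + 1)) * modular \<Phi> \<gamma> (\<lambda>t. F (c * t))"
    using c by (simp add: powr_add ennreal_mult' mult_ac)
  finally show ?thesis .
qed

lemma gauge_norm_le:
  "0 < l \<Longrightarrow> modular \<Phi> \<gamma> (\<lambda>t. F t / ennreal l) \<le> 1 \<Longrightarrow> gauge_norm \<Phi> \<gamma> F \<le> ennreal l"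
  unfolding gauge_norm_def by (rule Inf_lower) auto

lemma gauge_norm_mono:
  assumes "mono \<Phi>" "\<And>t. 0 < t \<Longrightarrow> F t \<le> G t"
  shows "gauge_norm \<Phi> \<gamma> F \<le> gauge_norm \<Phi> \<gamma> G"
  unfolding gauge_norm_def
proof (rule Inf_superset_mono, clarify)
  fix l :: real assume l: "0 < l" "modular \<Phi> \<gamma> (\<lambda>t. G t / ennreal l) \<le> 1"
  have "modular \<Phi> \<gamma> (\<lambda>t. F t / ennreal l) \<le> modular \<Phi> \<gamma> (\<lambda>t. G t / ennreal l)"
    using assms by (intro modular_mono divide_right_mono_ennreal)
  with l show "\<exists>l'. ennreal l = ennreal l' \<and> 0 < l' \<and> modular \<Phi> \<gamma> (\<lambda>t. F t / ennreal l') \<le> 1"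
    by (intro exI[of _ l]) auto
qed

lemma gauge_norm_less_imp_modular_le:
  assumes "mono \<Phi>" "gauge_norm \<Phi> \<gamma> F < ennreal l"
  shows "modular \<Phi> \<gamma> (\<lambda>t. F t / ennreal l) \<le> 1"
proof -
  obtain l' where l': "0 < l'" "modular \<Phi> \<gamma> (\<lambda>t. F t / ennreal l') \<le> 1" "ennreal l' < ennreal l"
    using assms(2) unfolding gauge_norm_def Inf_less_iff by auto
  have "F t / ennreal l \<le> F t / ennreal l'" for t
    using l' unfolding divide_ennreal_def
    by (intro mult_left_mono) (auto simp: ennreal_less_iff inverse_ennreal intro!: ennreal_leI le_imp_inverse_le)
  then show ?thesis
    using modular_mono[OF assms(1), of "\<lambda>t. F t / ennreal l" "\<lambda>t. F t / ennreal l'" \<gamma>] l'(2)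
    by (auto intro: order_trans)
qed

lemma gauge_norm_le_mult:
  assumes c: "0 < c"
    and step: "\<And>l. 0 < l \<Longrightarrow> modular \<Phi> \<gamma> (\<lambda>t. F t / ennreal l) \<le> 1
      \<Longrightarrow> modular \<Phi>' \<gamma> (\<lambda>t. G t / ennreal (c * l)) \<le> 1"
  shows "gauge_norm \<Phi>' \<gamma> G \<le> ennreal c * gauge_norm \<Phi> \<gamma> F"
proof -
  have "gauge_norm \<Phi>' \<gamma> G / ennreal c \<le> gauge_norm \<Phi> \<gamma> F"
    unfolding gauge_norm_def[of \<Phi>]
  proof (rule Inf_greatest, clarify)
    fix l :: real assume l: "0 < l" "modular \<Phi> \<gamma> (\<lambda>t. F t / ennreal l) \<le> 1"
    have "gauge_norm \<Phi>' \<gamma> G \<le> ennreal (c * l)"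
      using l c by (intro gauge_norm_le step) auto
    then have "gauge_norm \<Phi>' \<gamma> G / ennreal c \<le> ennreal (c * l) / ennreal c"
      by (rule divide_right_mono_ennreal)
    also have "\<dots> = ennreal l" using c l by (simp add: divide_ennreal)
    finally show "gauge_norm \<Phi>' \<gamma> G / ennreal c \<le> ennreal l" .
  qed
  then have "ennreal c * (gauge_norm \<Phi>' \<gamma> G / ennreal c) \<le> ennreal c * gauge_norm \<Phi> \<gamma> F"
    by (rule mult_left_mono) simp
  moreover have "ennreal c * (gauge_norm \<Phi>' \<gamma> G / ennreal c) = gauge_norm \<Phi>' \<gamma> G"
    using c by (simp add: ennreal_times_divide mult.commute[of "ennreal c"] mult_divide_eq_ennreal)
  ultimately show ?thesis by simp
qed

section \<open>The operator on nonnegative functions\<close>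

lemma hardy_nonneg_tail:
  "hardy_nonneg q F t = ennreal (t powr (- (1 / q))) * tail_integral (\<lambda>s. F s * ennreal (s powr (1 / q - 1))) t"
  by (simp add: hardy_nonneg_def tail_integral_def)

lemma hardy_nonneg_mono:
  "(\<And>s. t < s \<Longrightarrow> F s \<le> G s) \<Longrightarrow> hardy_nonneg q F t \<le> hardy_nonneg q G t"
  unfolding hardy_nonneg_def
  by (intro mult_left_mono nn_integral_mono) (auto simp: indicator_def intro!: mult_right_mono)

lemma hardy_nonneg_cong:
  "(\<And>s. t < s \<Longrightarrow> F s = G s) \<Longrightarrow> hardy_nonneg q F t = hardy_nonneg q G t"
  by (intro antisym hardy_nonneg_mono) auto

lemma hardy_nonneg_measurable [measurable]: "hardy_nonneg q F \<in> borel_measurable lebesgue"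
  unfolding hardy_nonneg_tail by (rule borel_imp_lebesgue_measurable) measurable

lemma hardy_nonneg_cmult:
  assumes [measurable]: "F \<in> borel_measurable lebesgue"
  shows "hardy_nonneg q (\<lambda>s. c * F s) t = c * hardy_nonneg q F t"
  unfolding hardy_nonneg_def by (simp add: nn_integral_cmult mult.assoc mult.left_commute[of _ c])

lemma hardy_nonneg_dilation:
  assumes [measurable]: "F \<in> borel_measurable lebesgue" and "0 < c" "0 < t"
  shows "hardy_nonneg q (\<lambda>s. F (c * s)) t = hardy_nonneg q F (c * t)"
proof -
  have "(c * t) powr (- (1 / q)) * c powr (1 / q - 1 + 1) = t powr (- (1 / q))"
    using assms by (simp add: powr_mult powr_minus field_simps)
  then have "ennreal ((c * t) powr (- (1 / q))) * ennreal (c powr (1 / q - 1 + 1))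
      = ennreal (t powr (- (1 / q)))"
    by (simp only: ennreal_mult'[symmetric] powr_ge_zero)
  then show ?thesis
    unfolding hardy_nonneg_tail tail_integral_dilation[OF assms] by (simp only: mult.assoc[symmetric])
qed

section \<open>Norm inequality and modular inequality\<close>

definition hardy_gauge_bound ::
    "real \<Rightarrow> real \<Rightarrow> (ennreal \<Rightarrow> ennreal) \<Rightarrow> (ennreal \<Rightarrow> ennreal) \<Rightarrow> bool" where
  "hardy_gauge_bound q \<gamma> \<Phi>1 \<Phi>2 \<longleftrightarrow>
     (\<exists>L>0. \<forall>f\<in>half_line_measurable. (\<forall>t>0. 0 \<le> f t) \<longrightarrow>
        gauge_norm \<Phi>1 \<gamma> (hardy_nonneg q (\<lambda>s. ennreal (f s)))
          \<le> ennreal L * gauge_norm \<Phi>2 \<gamma> (\<lambda>s. ennreal (f s)))"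

definition hardy_modular_bound ::
    "real \<Rightarrow> real \<Rightarrow> (ennreal \<Rightarrow> ennreal) \<Rightarrow> (ennreal \<Rightarrow> ennreal) \<Rightarrow> bool" where
  "hardy_modular_bound q \<gamma> \<Phi>1 \<Phi>2 \<longleftrightarrow>
     (\<exists>K>0. \<forall>f\<in>half_line_measurable. (\<forall>t>0. 0 \<le> f t) \<longrightarrow>
        modular \<Phi>1 \<gamma> (hardy_nonneg q (\<lambda>s. ennreal (f s)))
          \<le> modular \<Phi>2 \<gamma> (\<lambda>s. ennreal (K * \<bar>f s\<bar>)))"

lemma half_line_measurable_extend:
  fixes f :: "real \<Rightarrow> real"
  assumes "f \<in> half_line_measurable"
  shows "(\<lambda>s. indicator {0<..} s * f s) \<in> borel_measurable lebesgue"
  using assms unfolding half_line_measurable_def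
  by (subst (asm) borel_measurable_restrict_space_iff) auto

lemma half_line_measurableI:
  fixes f :: "real \<Rightarrow> real"
  shows "f \<in> borel_measurable lebesgue \<Longrightarrow> f \<in> half_line_measurable"
  unfolding half_line_measurable_def by (rule measurable_restrict_space1)

lemma half_line_measurable_cmult: "f \<in> half_line_measurable \<Longrightarrow> (\<lambda>s. c * f s) \<in> half_line_measurable"
  unfolding half_line_measurable_def by measurable

lemma half_line_measurable_abs: "f \<in> half_line_measurable \<Longrightarrow> (\<lambda>s. \<bar>f s\<bar>) \<in> half_line_measurable"
  unfolding half_line_measurable_def by measurable

lemma half_line_measurable_diff:
  "f \<in> half_line_measurable \<Longrightarrow> g \<in> half_line_measurable \<Longrightarrow> (\<lambda>s. f s - g s) \<in> half_line_measurable"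
  unfolding half_line_measurable_def by measurable

lemma hardy_nonneg_real_cmult:
  assumes "f \<in> half_line_measurable" "0 \<le> c" "0 < t"
  shows "hardy_nonneg q (\<lambda>s. ennreal (c * f s)) t = ennreal c * hardy_nonneg q (\<lambda>s. ennreal (f s)) t"
proof -
  note [measurable] = half_line_measurable_extend[OF assms(1)]
  have "hardy_nonneg q (\<lambda>s. ennreal (c * f s)) t
      = hardy_nonneg q (\<lambda>s. ennreal c * ennreal (indicator {0<..} s * f s)) t"
    using assms by (intro hardy_nonneg_cong) (auto simp: ennreal_mult')
  also have "\<dots> = ennreal c * hardy_nonneg q (\<lambda>s. ennreal (indicator {0<..} s * f s)) t"
    by (rule hardy_nonneg_cmult) measurable
  also have "hardy_nonneg q (\<lambda>s. ennreal (indicator {0<..} s * f s)) t = hardy_nonneg q (\<lambda>s. ennreal (f s)) t"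
    using assms by (intro hardy_nonneg_cong) auto
  finally show ?thesis .
qed

lemma ennreal_divide_1 [simp]: "x / 1 = (x :: ennreal)"
  by (simp add: divide_ennreal_def)

lemma ennreal_divide_eq_mult: "0 < l \<Longrightarrow> x / ennreal l = ennreal (1 / l) * x"
  by (simp add: divide_ennreal_def inverse_ennreal inverse_eq_divide mult.commute)

text \<open>A dilation by \<open>c\<close> divides modulars by \<open>c\<^sup>\<gamma>\<^sup>+\<^sup>1\<close>. Since \<open>\<gamma> \<noteq> -1\<close>, this factor can be any
  positive number \<open>r\<close>, so a function of modular less than \<open>r\<close> is moved into the unit ball,
  and the operator commutes with dilations; hence a bound on the unit ball gives the bound for the
  modular itself. Passing from \<open>L\<close> to \<open>2L\<close> replaces the attainment of the infimum in the gauge.\<close>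
lemma modular_bound_of_gauge_bound:
  assumes mono: "mono \<Phi>1" "mono \<Phi>2" and "\<gamma> \<noteq> -1" and G: "hardy_gauge_bound q \<gamma> \<Phi>1 \<Phi>2"
  shows "hardy_modular_bound q \<gamma> \<Phi>1 \<Phi>2"
proof -
  obtain L where L: "0 < L" "\<And>f. f \<in> half_line_measurable \<Longrightarrow> \<forall>t>0. 0 \<le> f t \<Longrightarrow>
      gauge_norm \<Phi>1 \<gamma> (hardy_nonneg q (\<lambda>s. ennreal (f s)))
        \<le> ennreal L * gauge_norm \<Phi>2 \<gamma> (\<lambda>s. ennreal (f s))"
    using G unfolding hardy_gauge_bound_def by blast
  define K where "K = 2 * L"
  have "0 < K" using L by (simp add: K_def)
  have "modular \<Phi>1 \<gamma> (hardy_nonneg q (\<lambda>s. ennreal (f s))) \<le> modular \<Phi>2 \<gamma> (\<lambda>s. ennreal (K * \<bar>f s\<bar>))"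
    if f: "f \<in> half_line_measurable" "\<forall>t>0. 0 \<le> f t" for f
  proof (rule dense_ge)
    fix B assume B: "modular \<Phi>2 \<gamma> (\<lambda>s. ennreal (K * \<bar>f s\<bar>)) < B"
    define g where "g = (\<lambda>s. indicator {0<..} s * (K * f s))"
    have [measurable]: "g \<in> borel_measurable lebesgue"
      unfolding g_def by (intro half_line_measurable_extend half_line_measurable_cmult f)
    have gnn: "0 \<le> g s" for s using f \<open>0 < K\<close> by (auto simp: g_def indicator_def)
    show "modular \<Phi>1 \<gamma> (hardy_nonneg q (\<lambda>s. ennreal (f s))) \<le> B"
    proof (cases B)
      case (real r)
      with B have r: "0 < r" by (cases "r = 0") auto
      define c where "c = r powr (1 / (\<gamma> + 1))"
      have c: "0 < c" "c powr (\<gamma> + 1) = r"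
        using r \<open>\<gamma> \<noteq> -1\<close> by (auto simp: c_def powr_powr)
      let ?g = "\<lambda>s. g (c * s)"
      have "ennreal r * modular \<Phi>2 \<gamma> (\<lambda>t. ennreal (?g t)) = modular \<Phi>2 \<gamma> (\<lambda>t. ennreal (g t))"
        using modular_dilation[OF mono(2), of "\<lambda>t. ennreal (g t)" c \<gamma>] c by simp
      also have "\<dots> = modular \<Phi>2 \<gamma> (\<lambda>s. ennreal (K * \<bar>f s\<bar>))"
        using f by (intro modular_cong) (auto simp: g_def)
      also have "\<dots> \<le> ennreal r * 1" using B real by simp
      finally have "modular \<Phi>2 \<gamma> (\<lambda>t. ennreal (?g t)) \<le> 1"
        using r by (subst (asm) ennreal_mult_le_mult_iff) auto
      then have ball: "gauge_norm \<Phi>2 \<gamma> (\<lambda>t. ennreal (?g t)) \<le> ennreal 1"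
        by (intro gauge_norm_le) auto
      have "gauge_norm \<Phi>1 \<gamma> (hardy_nonneg q (\<lambda>s. ennreal (?g s)))
          \<le> ennreal L * gauge_norm \<Phi>2 \<gamma> (\<lambda>t. ennreal (?g t))"
        using gnn by (intro L half_line_measurableI lebesgue_measurable_dilation) auto
      also have "\<dots> \<le> ennreal L * ennreal 1"
        by (intro mult_left_mono ball) simp
      also have "\<dots> < ennreal K" using L by (auto simp: K_def ennreal_less_iff)
      finally have "modular \<Phi>1 \<gamma> (\<lambda>t. hardy_nonneg q (\<lambda>s. ennreal (?g s)) t / ennreal K) \<le> 1"
        by (rule gauge_norm_less_imp_modular_le[OF mono(1)])
      then have unit: "modular \<Phi>1 \<gamma> (\<lambda>t. hardy_nonneg q (\<lambda>s. ennreal (g s)) (c * t) / ennreal K) \<le> 1"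
        using c by (subst (asm) modular_cong[where G = "\<lambda>t. hardy_nonneg q (\<lambda>s. ennreal (g s)) (c * t) / ennreal K"])
          (auto simp: hardy_nonneg_dilation[where F = "\<lambda>s. ennreal (g s)"])
      have "modular \<Phi>1 \<gamma> (hardy_nonneg q (\<lambda>s. ennreal (f s)))
          = modular \<Phi>1 \<gamma> (\<lambda>t. hardy_nonneg q (\<lambda>s. ennreal (g s)) t / ennreal K)"
      proof (rule modular_cong)
        fix t :: real assume t: "0 < t"
        have "hardy_nonneg q (\<lambda>s. ennreal (g s)) t = hardy_nonneg q (\<lambda>s. ennreal (K * f s)) t"
          using t by (intro hardy_nonneg_cong) (simp add: g_def)
        also have "\<dots> = ennreal K * hardy_nonneg q (\<lambda>s. ennreal (f s)) t"
          using f t \<open>0 < K\<close> by (intro hardy_nonneg_real_cmult) auto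
        finally show "hardy_nonneg q (\<lambda>s. ennreal (f s)) t
            = hardy_nonneg q (\<lambda>s. ennreal (g s)) t / ennreal K"
          using \<open>0 < K\<close> by (simp add: mult.commute[of "ennreal K"] mult_divide_eq_ennreal)
      qed
      also have "\<dots> = ennreal r * modular \<Phi>1 \<gamma> (\<lambda>t. hardy_nonneg q (\<lambda>s. ennreal (g s)) (c * t) / ennreal K)"
        using c by (subst modular_dilation[OF mono(1) _ c(1)]) auto
      also have "\<dots> \<le> ennreal r * 1" by (intro mult_left_mono unit) simp
      finally show ?thesis using real by simp
    qed simp
  qed
  then show ?thesis unfolding hardy_modular_bound_def using \<open>0 < K\<close> by blast
qed

text \<open>Apply the modular inequality to \<open>f/(Kl)\<close> for each admissible \<open>l\<close> in the gauge of \<open>f\<close>.\<close>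
lemma gauge_bound_of_modular_bound:
  assumes M: "hardy_modular_bound q \<gamma> \<Phi>1 \<Phi>2"
  shows "hardy_gauge_bound q \<gamma> \<Phi>1 \<Phi>2"
proof -
  obtain K where K: "0 < K" "\<And>f. f \<in> half_line_measurable \<Longrightarrow> \<forall>t>0. 0 \<le> f t \<Longrightarrow>
      modular \<Phi>1 \<gamma> (hardy_nonneg q (\<lambda>s. ennreal (f s))) \<le> modular \<Phi>2 \<gamma> (\<lambda>s. ennreal (K * \<bar>f s\<bar>))"
    using M unfolding hardy_modular_bound_def by blast
  have "gauge_norm \<Phi>1 \<gamma> (hardy_nonneg q (\<lambda>s. ennreal (f s)))
      \<le> ennreal K * gauge_norm \<Phi>2 \<gamma> (\<lambda>s. ennreal (f s))"
    if f: "f \<in> half_line_measurable" "\<forall>t>0. 0 \<le> f t" for f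
  proof (rule gauge_norm_le_mult[OF K(1)])
    fix l :: real
    assume l: "0 < l" "modular \<Phi>2 \<gamma> (\<lambda>t. ennreal (f t) / ennreal l) \<le> 1"
    let ?c = "1 / (K * l)"
    have c: "0 < ?c" "0 \<le> ?c" using K l by auto
    have "modular \<Phi>1 \<gamma> (\<lambda>t. hardy_nonneg q (\<lambda>s. ennreal (f s)) t / ennreal (K * l))
        = modular \<Phi>1 \<gamma> (hardy_nonneg q (\<lambda>s. ennreal (?c * f s)))"
      using K l c f by (intro modular_cong)
        (simp only: hardy_nonneg_real_cmult ennreal_divide_eq_mult mult_pos_pos)
    also have "\<dots> \<le> modular \<Phi>2 \<gamma> (\<lambda>s. ennreal (K * \<bar>?c * f s\<bar>))"
      using f c by (intro K half_line_measurable_cmult) auto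
    also have "\<dots> = modular \<Phi>2 \<gamma> (\<lambda>t. ennreal (f t) / ennreal l)"
      using f K l by (intro modular_cong) (auto simp: divide_ennreal abs_mult)
    finally show "modular \<Phi>1 \<gamma> (\<lambda>t. hardy_nonneg q (\<lambda>s. ennreal (f s)) t / ennreal (K * l)) \<le> 1"
      using l(2) by simp
  qed
  then show ?thesis unfolding hardy_gauge_bound_def using K(1) by blast
qed

section \<open>Continuity between the Orlicz classes\<close>

lemma modular_top:
  assumes "\<Phi> top = top" "0 < t" "\<And>x. 0 < x \<Longrightarrow> x < t \<Longrightarrow> F x = top"
  shows "modular \<Phi> \<gamma> F = top"
proof -
  have "top = (\<integral>\<^sup>+ x. top * indicator {0<..<t} x \<partial>lebesgue)"
    using \<open>0 < t\<close> by (subst nn_integral_cmult_indicator) (auto simp: ennreal_top_mult)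
  also have "\<dots> \<le> modular \<Phi> \<gamma> F"
    unfolding modular_def using assms
    by (intro nn_integral_mono) (auto simp: indicator_def ennreal_top_mult)
  finally show ?thesis by (simp add: top_unique)
qed

text \<open>If the tail integral is infinite at \<open>t\<close>, it is infinite everywhere to the left of \<open>t\<close>, and the
  modular is infinite because \<open>\<Phi>(\<infinity>) = \<infinity>\<close>. So a finite modular makes \<open>Q f\<close> finite everywhere and not
  only almost everywhere.\<close>
lemma hardy_nonneg_finite:
  assumes "\<Phi> top = top" "modular \<Phi> \<gamma> (hardy_nonneg q F) < \<infinity>" "0 < t"
  shows "hardy_nonneg q F t < \<infinity>"
proof (rule ccontr)
  assume "\<not> ?thesis"
  then have top: "tail_integral (\<lambda>s. F s * ennreal (s powr (1 / q - 1))) t = top"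
    unfolding hardy_nonneg_tail by (auto simp: ennreal_mult_less_top not_less top_unique)
  have "hardy_nonneg q F x = top" if "0 < x" "x < t" for x
    unfolding hardy_nonneg_tail
    using tail_integral_antimono[of x t "\<lambda>s. F s * ennreal (s powr (1 / q - 1))"] that top
    by (auto simp: top_unique ennreal_mult_top)
  then have "modular \<Phi> \<gamma> (hardy_nonneg q F) = top"
    using assms by (intro modular_top[of _ t]) auto
  then show False using assms by simp
qed

lemma hardy_definedI:
  assumes f: "f \<in> half_line_measurable"
    and fin: "\<And>t. 0 < t \<Longrightarrow> hardy_nonneg q (\<lambda>s. ennreal \<bar>f s\<bar>) t < \<infinity>"
  shows "hardy_defined q f"
  unfolding hardy_defined_def set_integrable_def
proof (intro allI impI integrableI_bounded)
  fix t :: real assume t: "0 < t"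
  note [measurable] = half_line_measurable_extend[OF f]
  have [measurable]: "(\<lambda>s::real. s powr (1 / q - 1)) \<in> borel_measurable lebesgue"
    by (rule borel_imp_lebesgue_measurable) measurable
  have "(\<lambda>s. indicator {t<..} s *\<^sub>R (f s * s powr (1 / q - 1)))
      = (\<lambda>s. indicator {t<..} s * ((indicator {0<..} s * f s) * s powr (1 / q - 1)))"
    using t by (auto simp: indicator_def)
  then show "(\<lambda>s. indicator {t<..} s *\<^sub>R (f s * s powr (1 / q - 1))) \<in> borel_measurable lebesgue"
    by simp
  have "tail_integral (\<lambda>s. ennreal \<bar>f s\<bar> * ennreal (s powr (1 / q - 1))) t < \<infinity>"
    using fin[OF t] t unfolding hardy_nonneg_tail by (auto simp: ennreal_mult_less_top)
  also have "tail_integral (\<lambda>s. ennreal \<bar>f s\<bar> * ennreal (s powr (1 / q - 1))) t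
      = (\<integral>\<^sup>+ s. ennreal (norm (indicator {t<..} s *\<^sub>R (f s * s powr (1 / q - 1)))) \<partial>lebesgue)"
    unfolding tail_integral_def
    by (intro nn_integral_cong) (auto simp: indicator_def abs_mult ennreal_mult')
  finally show "(\<integral>\<^sup>+ s. ennreal (norm (indicator {t<..} s *\<^sub>R (f s * s powr (1 / q - 1)))) \<partial>lebesgue) < \<infinity>" .
qed

text \<open>The positive and the negative part of the integrand have nonincreasing tail integrals.\<close>
lemma hardy_Q_measurable:
  assumes "hardy_defined q f"
  shows "hardy_Q q f \<in> half_line_measurable"
proof -
  let ?h = "\<lambda>c s. ennreal (c * (f s * s powr (1 / q - 1)))"
  have eq: "hardy_Q q f t = t powr (- (1 / q)) *
      (enn2real (tail_integral (?h 1) t) - enn2real (tail_integral (?h (-1)) t))" if "0 < t" for t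
    using assms that unfolding hardy_defined_def set_integrable_def hardy_Q_def
      set_lebesgue_integral_def tail_integral_def
    by (subst real_lebesgue_integral_def)
      (auto intro!: arg_cong2[where f = "(-)"] arg_cong[where f = enn2real] nn_integral_cong simp: indicator_def)
  have "(\<lambda>t. t powr (- (1 / q)) *
      (enn2real (tail_integral (?h 1) t) - enn2real (tail_integral (?h (-1)) t))) \<in> borel_measurable lebesgue"
    by (rule borel_imp_lebesgue_measurable) measurable
  then have "(\<lambda>t. t powr (- (1 / q)) *
      (enn2real (tail_integral (?h 1) t) - enn2real (tail_integral (?h (-1)) t))) \<in> half_line_measurable"
    by (rule half_line_measurableI)
  then show ?thesis
    unfolding half_line_measurable_def by (rule measurable_cong[THEN iffD1, rotated]) (simp add: eq)
qed

lemma hardy_Q_le_hardy_nonneg: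
  assumes "hardy_defined q f" "0 < t"
  shows "ennreal \<bar>hardy_Q q f t\<bar> \<le> hardy_nonneg q (\<lambda>s. ennreal \<bar>f s\<bar>) t"
proof -
  let ?g = "\<lambda>s. indicator {t<..} s *\<^sub>R (f s * s powr (1 / q - 1))"
  have "integrable lebesgue ?g"
    using assms by (auto simp: hardy_defined_def set_integrable_def)
  then have "ennreal (norm (integral\<^sup>L lebesgue ?g)) \<le> (\<integral>\<^sup>+ s. ennreal (norm (?g s)) \<partial>lebesgue)"
    by (rule integral_norm_bound_ennreal)
  also have "\<dots> = tail_integral (\<lambda>s. ennreal \<bar>f s\<bar> * ennreal (s powr (1 / q - 1))) t"
    unfolding tail_integral_def
    by (intro nn_integral_cong) (auto simp: indicator_def abs_mult ennreal_mult')
  finally show ?thesis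
    unfolding hardy_nonneg_tail hardy_Q_def set_lebesgue_integral_def
    by (simp add: abs_mult ennreal_mult' mult_left_mono)
qed

lemma hardy_Q_diff:
  assumes "hardy_defined q f" "hardy_defined q g"
  shows "hardy_defined q (\<lambda>s. g s - f s)"
    and "0 < t \<Longrightarrow> hardy_Q q (\<lambda>s. g s - f s) t = hardy_Q q g t - hardy_Q q f t"
  using assms unfolding hardy_defined_def hardy_Q_def
  by (simp_all add: left_diff_distrib set_integral_diff right_diff_distrib)

text \<open>The modular inequality for a small multiple of \<open>\<bar>f\<bar>\<close> shows that \<open>Q f\<close> exists and lies in the
  target class. Continuity follows from \<open>\<bar>Q g - Q f\<bar> \<le> Q \<bar>g - f\<bar>\<close> and the norm inequality.\<close>
lemma orlicz_continuous_of_modular_bound: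
  assumes mono: "mono \<Phi>1" and top: "\<Phi>1 top = top" and M: "hardy_modular_bound q \<gamma> \<Phi>1 \<Phi>2"
  shows "(\<forall>f\<in>orlicz_class \<Phi>2 \<gamma>. hardy_defined q f \<and> hardy_Q q f \<in> orlicz_class \<Phi>1 \<gamma>) \<and>
      orlicz_continuous \<Phi>2 \<Phi>1 \<gamma> (hardy_Q q)"
proof -
  obtain K where K: "0 < K" "\<And>f. f \<in> half_line_measurable \<Longrightarrow> \<forall>t>0. 0 \<le> f t \<Longrightarrow>
      modular \<Phi>1 \<gamma> (hardy_nonneg q (\<lambda>s. ennreal (f s))) \<le> modular \<Phi>2 \<gamma> (\<lambda>s. ennreal (K * \<bar>f s\<bar>))"
    using M unfolding hardy_modular_bound_def by blast
  obtain L where L: "0 < L" "\<And>f. f \<in> half_line_measurable \<Longrightarrow> \<forall>t>0. 0 \<le> f t \<Longrightarrow>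
      gauge_norm \<Phi>1 \<gamma> (hardy_nonneg q (\<lambda>s. ennreal (f s)))
        \<le> ennreal L * gauge_norm \<Phi>2 \<gamma> (\<lambda>s. ennreal (f s))"
    using gauge_bound_of_modular_bound[OF M] unfolding hardy_gauge_bound_def by blast
  have maps: "hardy_defined q f \<and> hardy_Q q f \<in> orlicz_class \<Phi>1 \<gamma>"
    if f: "f \<in> orlicz_class \<Phi>2 \<gamma>" for f
  proof -
    obtain k where k: "0 < k" "modular \<Phi>2 \<gamma> (\<lambda>t. ennreal (k * \<bar>f t\<bar>)) < \<infinity>"
      and fm: "f \<in> half_line_measurable"
      using f unfolding orlicz_class_def by blast
    let ?c = "k / K"
    have c: "0 < ?c" using k K by simp
    have "modular \<Phi>1 \<gamma> (hardy_nonneg q (\<lambda>s. ennreal (?c * \<bar>f s\<bar>)))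
        \<le> modular \<Phi>2 \<gamma> (\<lambda>s. ennreal (K * \<bar>?c * \<bar>f s\<bar>\<bar>))"
      using fm k K by (intro K half_line_measurable_cmult half_line_measurable_abs) auto
    also have "(\<lambda>s. ennreal (K * \<bar>?c * \<bar>f s\<bar>\<bar>)) = (\<lambda>s. ennreal (k * \<bar>f s\<bar>))"
      using k K by (auto simp: abs_mult)
    finally have fin: "modular \<Phi>1 \<gamma> (hardy_nonneg q (\<lambda>s. ennreal (?c * \<bar>f s\<bar>))) < \<infinity>"
      using k(2) by (rule le_less_trans)
    have scale: "hardy_nonneg q (\<lambda>s. ennreal (?c * \<bar>f s\<bar>)) t
        = ennreal ?c * hardy_nonneg q (\<lambda>s. ennreal \<bar>f s\<bar>) t" if "0 < t" for t
      using that c fm by (intro hardy_nonneg_real_cmult half_line_measurable_abs) auto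
    have "hardy_nonneg q (\<lambda>s. ennreal \<bar>f s\<bar>) t < \<infinity>" if "0 < t" for t
      using hardy_nonneg_finite[OF top fin that] c unfolding scale[OF that]
      by (auto simp: ennreal_mult_less_top ennreal_eq_0_iff simp del: zero_less_divide_iff divide_le_0_iff)
    then have def: "hardy_defined q f" by (intro hardy_definedI fm)
    have "modular \<Phi>1 \<gamma> (\<lambda>t. ennreal (?c * \<bar>hardy_Q q f t\<bar>))
        \<le> modular \<Phi>1 \<gamma> (hardy_nonneg q (\<lambda>s. ennreal (?c * \<bar>f s\<bar>)))"
    proof (rule modular_mono[OF mono])
      fix t :: real assume t: "0 < t"
      show "ennreal (?c * \<bar>hardy_Q q f t\<bar>) \<le> hardy_nonneg q (\<lambda>s. ennreal (?c * \<bar>f s\<bar>)) t"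
        unfolding scale[OF t] using c
        by (subst ennreal_mult') (auto intro!: mult_left_mono hardy_Q_le_hardy_nonneg def t)
    qed
    then have "modular \<Phi>1 \<gamma> (\<lambda>t. ennreal (?c * \<bar>hardy_Q q f t\<bar>)) < \<infinity>"
      using fin by (rule le_less_trans)
    then show ?thesis
      using def c hardy_Q_measurable[OF def] unfolding orlicz_class_def by blast
  qed
  have "orlicz_continuous \<Phi>2 \<Phi>1 \<gamma> (hardy_Q q)"
    unfolding orlicz_continuous_def
  proof (intro ballI allI impI)
    fix f and \<epsilon> :: real assume f: "f \<in> orlicz_class \<Phi>2 \<gamma>" and \<epsilon>: "0 < \<epsilon>"
    show "\<exists>\<delta>>0. \<forall>g\<in>orlicz_class \<Phi>2 \<gamma>.
        gauge_norm \<Phi>2 \<gamma> (\<lambda>t. ennreal \<bar>g t - f t\<bar>) < ennreal \<delta> \<longrightarrow>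
        gauge_norm \<Phi>1 \<gamma> (\<lambda>t. ennreal \<bar>hardy_Q q g t - hardy_Q q f t\<bar>) < ennreal \<epsilon>"
    proof (intro exI[of _ "\<epsilon> / L"] conjI ballI impI)
      show "0 < \<epsilon> / L" using \<epsilon> L by simp
      fix g assume g: "g \<in> orlicz_class \<Phi>2 \<gamma>"
        and close: "gauge_norm \<Phi>2 \<gamma> (\<lambda>t. ennreal \<bar>g t - f t\<bar>) < ennreal (\<epsilon> / L)"
      have meas: "(\<lambda>t. \<bar>g t - f t\<bar>) \<in> half_line_measurable"
        using f g by (intro half_line_measurable_abs half_line_measurable_diff)
          (auto simp: orlicz_class_def)
      note diff = hardy_Q_diff[OF conjunct1[OF maps[OF f]] conjunct1[OF maps[OF g]]]
      have "gauge_norm \<Phi>1 \<gamma> (\<lambda>t. ennreal \<bar>hardy_Q q g t - hardy_Q q f t\<bar>)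
          \<le> gauge_norm \<Phi>1 \<gamma> (hardy_nonneg q (\<lambda>s. ennreal \<bar>g s - f s\<bar>))"
        using hardy_Q_le_hardy_nonneg[OF diff(1)] diff(2) by (intro gauge_norm_mono mono) simp
      also have "\<dots> \<le> ennreal L * gauge_norm \<Phi>2 \<gamma> (\<lambda>t. ennreal \<bar>g t - f t\<bar>)"
        by (intro L meas) auto
      also have "\<dots> < ennreal L * ennreal (\<epsilon> / L)"
        using L close by (intro ennreal_mult_strict_left_mono) auto
      also have "\<dots> = ennreal \<epsilon>" using L \<epsilon> by (simp flip: ennreal_mult')
      finally show "gauge_norm \<Phi>1 \<gamma> (\<lambda>t. ennreal \<bar>hardy_Q q g t - hardy_Q q f t\<bar>) < ennreal \<epsilon>" .
    qed
  qed
  with maps show ?thesis by blast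
qed

text \<open>Continuity at the zero function with \<open>\<epsilon> = 1\<close> yields a \<open>\<delta>\<close>; a multiple of \<open>f\<close> of norm at most
  \<open>\<delta>/2\<close> has an image of norm less than \<open>1\<close>, and homogeneity does the rest.\<close>
lemma gauge_bound_of_orlicz_continuous:
  assumes mono: "mono \<Phi>1" and zero: "\<Phi>2 0 = 0"
    and maps: "\<forall>f\<in>orlicz_class \<Phi>2 \<gamma>. hardy_defined q f \<and> hardy_Q q f \<in> orlicz_class \<Phi>1 \<gamma>"
    and cont: "orlicz_continuous \<Phi>2 \<Phi>1 \<gamma> (hardy_Q q)"
  shows "hardy_gauge_bound q \<gamma> \<Phi>1 \<Phi>2"
proof -
  have z: "(\<lambda>_. 0) \<in> orlicz_class \<Phi>2 \<gamma>"
    using zero by (auto simp: orlicz_class_def half_line_measurable_def modular_def intro!: exI[of _ 1])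
  have Qz: "hardy_Q q (\<lambda>_. 0) t = 0" for t
    by (simp add: hardy_Q_def set_lebesgue_integral_def)
  obtain \<delta> where \<delta>: "0 < \<delta>" "\<And>g. g \<in> orlicz_class \<Phi>2 \<gamma> \<Longrightarrow>
      gauge_norm \<Phi>2 \<gamma> (\<lambda>t. ennreal \<bar>g t\<bar>) < ennreal \<delta> \<Longrightarrow>
      gauge_norm \<Phi>1 \<gamma> (\<lambda>t. ennreal \<bar>hardy_Q q g t\<bar>) < ennreal 1"
    using cont[unfolded orlicz_continuous_def, rule_format, OF z, of 1] Qz by auto
  have "gauge_norm \<Phi>1 \<gamma> (hardy_nonneg q (\<lambda>s. ennreal (f s)))
      \<le> ennreal (2 / \<delta>) * gauge_norm \<Phi>2 \<gamma> (\<lambda>s. ennreal (f s))"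
    if f: "f \<in> half_line_measurable" "\<forall>t>0. 0 \<le> f t" for f
  proof (rule gauge_norm_le_mult)
    show "0 < 2 / \<delta>" using \<delta> by simp
    fix l :: real
    assume l: "0 < l" "modular \<Phi>2 \<gamma> (\<lambda>t. ennreal (f t) / ennreal l) \<le> 1"
    define c where "c = \<delta> / (2 * l)"
    have c: "0 < c" using \<delta> l by (simp add: c_def)
    define g where "g = (\<lambda>s. c * f s)"
    have gm: "g \<in> half_line_measurable" unfolding g_def by (intro half_line_measurable_cmult f)
    have gnn: "0 \<le> g s" if "0 < s" for s using that c f by (simp add: g_def)
    have eq: "modular \<Phi>2 \<gamma> (\<lambda>t. ennreal ((2 / \<delta>) * \<bar>g t\<bar>)) = modular \<Phi>2 \<gamma> (\<lambda>t. ennreal (f t) / ennreal l)"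
      using f \<delta> l by (intro modular_cong) (auto simp: g_def c_def divide_ennreal abs_mult)
    then have "modular \<Phi>2 \<gamma> (\<lambda>t. ennreal ((2 / \<delta>) * \<bar>g t\<bar>)) < \<infinity>"
      using l(2) by (auto intro: le_less_trans)
    moreover have "0 < 2 / \<delta>" using \<delta> by simp
    ultimately have g: "g \<in> orlicz_class \<Phi>2 \<gamma>"
      using gm unfolding orlicz_class_def by blast
    have "modular \<Phi>2 \<gamma> (\<lambda>t. ennreal \<bar>g t\<bar> / ennreal (\<delta> / 2)) = modular \<Phi>2 \<gamma> (\<lambda>t. ennreal ((2 / \<delta>) * \<bar>g t\<bar>))"
      using \<delta> by (intro modular_cong) (auto simp: divide_ennreal mult_ac)
    then have "gauge_norm \<Phi>2 \<gamma> (\<lambda>t. ennreal \<bar>g t\<bar>) \<le> ennreal (\<delta> / 2)"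
      using l \<delta>(1) by (intro gauge_norm_le) (auto simp only: eq divide_pos_pos zero_less_numeral)
    also have "\<dots> < ennreal \<delta>" using \<delta> by (simp add: ennreal_less_iff)
    finally have "modular \<Phi>1 \<gamma> (\<lambda>t. ennreal \<bar>hardy_Q q g t\<bar> / ennreal 1) \<le> 1"
      by (intro gauge_norm_less_imp_modular_le mono \<delta> g)
    moreover have "modular \<Phi>1 \<gamma> (\<lambda>t. hardy_nonneg q (\<lambda>s. ennreal (f s)) t / ennreal (2 / \<delta> * l))
        = modular \<Phi>1 \<gamma> (\<lambda>t. ennreal \<bar>hardy_Q q g t\<bar> / ennreal 1)"
    proof (rule modular_cong)
      fix t :: real assume t: "0 < t"
      have def: "hardy_defined q g" using maps g by blast
      have "0 \<le> hardy_Q q g t"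
        unfolding hardy_Q_def set_lebesgue_integral_def using gnn t
        by (intro mult_nonneg_nonneg integral_nonneg_AE AE_I2) (auto simp: indicator_def)
      then have "ennreal \<bar>hardy_Q q g t\<bar> = hardy_nonneg q (\<lambda>s. ennreal (g s)) t"
        using hardy_nonneg_eq[OF def gnn t] by simp
      also have "\<dots> = ennreal c * hardy_nonneg q (\<lambda>s. ennreal (f s)) t"
        unfolding g_def using c f t by (intro hardy_nonneg_real_cmult) auto
      also have "\<dots> = hardy_nonneg q (\<lambda>s. ennreal (f s)) t / ennreal (2 / \<delta> * l)"
        using \<delta> l by (subst ennreal_divide_eq_mult) (auto simp: c_def)
      finally show "hardy_nonneg q (\<lambda>s. ennreal (f s)) t / ennreal (2 / \<delta> * l)
          = ennreal \<bar>hardy_Q q g t\<bar> / ennreal 1"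
        by simp
    qed
    ultimately show "modular \<Phi>1 \<gamma> (\<lambda>t. hardy_nonneg q (\<lambda>s. ennreal (f s)) t / ennreal (2 / \<delta> * l)) \<le> 1"
      by simp
  qed
  then show ?thesis unfolding hardy_gauge_bound_def using \<delta>(1) by (intro exI[of _ "2 / \<delta>"]) auto
qed

section \<open>The two weak conditions\<close>

lemma mono_young: "mono (young \<phi>)"
  by (intro monoI young_mono)

lemma powr_between:
  fixes s :: real
  assumes "0 < u" "u \<le> s" "s \<le> v"
  shows "min (u powr r) (v powr r) \<le> s powr r" "s powr r \<le> max (u powr r) (v powr r)"
  using assms powr_mono2[of r u s] powr_mono2[of r s v] powr_mono2'[of r u s] powr_mono2'[of r s v]
  by (cases "0 \<le> r"; force)+

lemma hardy_beta_tail: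
  "hardy_beta q \<gamma> \<Psi> t
     = tail_integral (\<lambda>s. \<Psi> (ennreal (s powr (1 / q - 1 - \<gamma>))) * ennreal (s powr \<gamma>)) t"
  by (simp add: hardy_beta_def tail_integral_def)

lemma hardy_beta_pos:
  assumes yd: "young_density \<phi>" and t: "0 < t"
  shows "0 < hardy_beta q \<gamma> (complementary \<phi>) t"
proof -
  let ?b = "1 / q - 1 - \<gamma>"
  define m where "m r = min (t powr r) ((2 * t) powr r)" for r
  have m: "0 < m r" for r using t by (simp add: m_def)
  have "0 < complementary \<phi> (ennreal (m ?b)) * ennreal (m \<gamma>) * ennreal t"
    using m t complementary_pos[OF yd m[of ?b]] by (simp add: ennreal_zero_less_mult_iff)
  also have "\<dots> = (\<integral>\<^sup>+ s. complementary \<phi> (ennreal (m ?b)) * ennreal (m \<gamma>) * indicator {t<..<2 * t} s \<partial>lebesgue)"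
    using t by (subst nn_integral_cmult_indicator) auto
  also have "\<dots> \<le> hardy_beta q \<gamma> (complementary \<phi>) t"
    unfolding hardy_beta_def
  proof (intro nn_integral_mono)
    fix s
    have "complementary \<phi> (ennreal (m ?b)) * ennreal (m \<gamma>)
       \<le> complementary \<phi> (ennreal (s powr ?b)) * ennreal (s powr \<gamma>)" if "t < s" "s < 2 * t"
      using powr_between(1)[of t s "2 * t"] that t
      unfolding complementary_def by (intro mult_mono young_mono ennreal_leI) (auto simp: m_def)
    then show "complementary \<phi> (ennreal (m ?b)) * ennreal (m \<gamma>) * indicator {t<..<2 * t} s
       \<le> complementary \<phi> (ennreal (s powr ?b)) * ennreal (s powr \<gamma>) * indicator {t<..} s"
      by (auto simp: indicator_def)
  qed
  finally show ?thesis .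
qed

text \<open>Put \<open>y = \<beta>(t)/(C s\<^sup>a)\<close>. After multiplication by \<open>\<beta>(t)/C\<close> the second condition bounds the
  integral of \<open>y \<phi>(y) s\<^sup>\<gamma>\<close> by \<open>\<beta>(t)\<close>, and \<open>\<Phi>(y) \<le> y \<phi>(y) \<le> \<Phi>(2y)\<close>; the factor \<open>2\<close> is absorbed by
  doubling \<open>C\<close>. Dividing \<open>\<beta>(t)/C\<close> out again requires \<open>\<beta>(t) > 0\<close>.\<close>
lemma weak_bound_iff_density_bound:
  assumes yd: "young_density \<phi>" and pos: "\<And>t. 0 < t \<Longrightarrow> 0 < \<beta> t"
  shows "(\<exists>C>0. \<forall>t>0.
        (\<integral>\<^sup>+ s \<in> {0<..<t}. young \<phi> (\<beta> t / ennreal (C * s powr a)) * ennreal (s powr \<gamma>) \<partial>lebesgue)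
          \<le> \<beta> t \<and> \<beta> t < \<infinity>)
    \<longleftrightarrow> (\<exists>C>0. \<forall>t>0. \<beta> t < \<infinity> \<and>
        (\<integral>\<^sup>+ s \<in> {0<..<t}. ennreal (\<phi> (enn2real (\<beta> t) / (C * s powr a)) * s powr (\<gamma> - a)) \<partial>lebesgue)
          \<le> ennreal C)"
    (is "(\<exists>C>0. \<forall>t>0. ?I C t \<le> \<beta> t \<and> \<beta> t < \<infinity>) \<longleftrightarrow> (\<exists>C>0. \<forall>t>0. \<beta> t < \<infinity> \<and> ?J C t \<le> ennreal C)")
proof -
  have mono: "mono_on {0<..} \<phi>" and nn: "\<And>s. 0 < s \<Longrightarrow> 0 \<le> \<phi> s"
    using yd by (auto simp: young_density_def)
  have J: "ennreal (b / C) * (\<integral>\<^sup>+ s \<in> {0<..<t}. ennreal (\<phi> (b / (C * s powr a)) * s powr (\<gamma> - a)) \<partial>lebesgue)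
      = (\<integral>\<^sup>+ s \<in> {0<..<t}. ennreal (b / (C * s powr a) * \<phi> (b / (C * s powr a))) * ennreal (s powr \<gamma>) \<partial>lebesgue)"
    if "0 < b" "0 < C" for b C t :: real
  proof -
    note [measurable] = mono_on_half_line_measurable[OF mono]
    let ?p = "\<lambda>s. indicator {0<..} s * \<phi> s"
    have "(\<lambda>s. ennreal (?p (b / (C * s powr a)) * s powr (\<gamma> - a)) * indicator {0<..<t} s) \<in> borel_measurable borel"
      by measurable
    then have [measurable]: "(\<lambda>s. ennreal (\<phi> (b / (C * s powr a)) * s powr (\<gamma> - a)) * indicator {0<..<t} s) \<in> borel_measurable lebesgue"
      using that by (intro borel_imp_lebesgue_measurable)
        (erule measurable_cong[THEN iffD1, rotated], auto simp: indicator_def)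
    have "ennreal (b / C) * (\<integral>\<^sup>+ s \<in> {0<..<t}. ennreal (\<phi> (b / (C * s powr a)) * s powr (\<gamma> - a)) \<partial>lebesgue)
       = (\<integral>\<^sup>+ s. ennreal (b / C) * (ennreal (\<phi> (b / (C * s powr a)) * s powr (\<gamma> - a)) * indicator {0<..<t} s) \<partial>lebesgue)"
      by (subst nn_integral_cmult) auto
    also have "\<dots> = (\<integral>\<^sup>+ s \<in> {0<..<t}. ennreal (b / (C * s powr a) * \<phi> (b / (C * s powr a))) * ennreal (s powr \<gamma>) \<partial>lebesgue)"
    proof (rule nn_integral_cong)
      fix s :: real
      have "ennreal (b / C) * ennreal (\<phi> (b / (C * s powr a)) * s powr (\<gamma> - a))
          = ennreal (b / (C * s powr a) * \<phi> (b / (C * s powr a))) * ennreal (s powr \<gamma>)" if "0 < s"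
        using that \<open>0 < b\<close> \<open>0 < C\<close> nn[of "b / (C * s powr a)"]
        by (simp add: powr_diff mult_ac flip: ennreal_mult')
      then show "ennreal (b / C) * (ennreal (\<phi> (b / (C * s powr a)) * s powr (\<gamma> - a)) * indicator {0<..<t} s)
          = ennreal (b / (C * s powr a) * \<phi> (b / (C * s powr a))) * ennreal (s powr \<gamma>) * indicator {0<..<t} s"
        by (auto simp: indicator_def)
    qed
    finally show ?thesis .
  qed
  have arg: "\<beta> t / ennreal (C * s powr a) = ennreal (enn2real (\<beta> t) / (C * s powr a))"
    if "0 < C" "0 < s" "\<beta> t < \<infinity>" for C s t
    using that by (cases "\<beta> t") (auto simp: divide_ennreal)
  have b: "0 < enn2real (\<beta> t)" "\<beta> t = ennreal (enn2real (\<beta> t))" if "0 < t" "\<beta> t < \<infinity>" for t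
    using pos[OF that(1)] that(2) by (auto simp: enn2real_positive_iff)
  have IJ: "?I C t \<le> ennreal (enn2real (\<beta> t) / C) * ?J C t" if "0 < C" "0 < t" "\<beta> t < \<infinity>" for C t
    unfolding J[OF b(1)[OF that(2,3)] that(1)]
  proof (intro nn_integral_mono)
    fix s :: real
    show "young \<phi> (\<beta> t / ennreal (C * s powr a)) * ennreal (s powr \<gamma>) * indicator {0<..<t} s
      \<le> ennreal (enn2real (\<beta> t) / (C * s powr a) * \<phi> (enn2real (\<beta> t) / (C * s powr a))) * ennreal (s powr \<gamma>) * indicator {0<..<t} s"
    proof (cases "0 < s")
      case True
      let ?y = "enn2real (\<beta> t) / (C * s powr a)"
      have "0 < ?y" using b(1)[OF that(2,3)] that True by simp
      then have "young \<phi> (\<beta> t / ennreal (C * s powr a)) \<le> ennreal (?y * \<phi> ?y)"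
        unfolding arg[OF that(1) True that(3)] by (rule young_le_mult[OF mono])
      then show ?thesis by (intro mult_right_mono) auto
    qed simp
  qed
  have JI: "ennreal (enn2real (\<beta> t) / (2 * C)) * ?J (2 * C) t \<le> ?I C t" if "0 < C" "0 < t" "\<beta> t < \<infinity>" for C t
  proof -
    have C2: "0 < 2 * C" using that by simp
    show ?thesis
      unfolding J[OF b(1)[OF that(2,3)] C2]
    proof (intro nn_integral_mono)
      fix s :: real
      let ?y = "enn2real (\<beta> t) / (2 * C * s powr a)"
      have "ennreal (?y * \<phi> ?y) \<le> young \<phi> (\<beta> t / ennreal (C * s powr a))" if s: "0 < s"
      proof -
        have y: "0 < ?y" using b(1)[OF \<open>0 < t\<close> \<open>\<beta> t < \<infinity>\<close>] \<open>0 < C\<close> s by simp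
        have "ennreal ((2 * ?y - ?y) * \<phi> ?y) \<le> young \<phi> (ennreal (2 * ?y))"
          using y by (intro mult_le_young mono) auto
        then show ?thesis using s \<open>0 < C\<close> \<open>\<beta> t < \<infinity>\<close> by (simp add: arg mult.assoc)
      qed
      then show "ennreal (?y * \<phi> ?y) * ennreal (s powr \<gamma>) * indicator {0<..<t} s
        \<le> young \<phi> (\<beta> t / ennreal (C * s powr a)) * ennreal (s powr \<gamma>) * indicator {0<..<t} s"
        by (auto simp: indicator_def intro!: mult_right_mono)
    qed
  qed
  show ?thesis
  proof (intro iffI; elim exE conjE)
    fix C :: real assume C: "0 < C" and I: "\<forall>t>0. ?I C t \<le> \<beta> t \<and> \<beta> t < \<infinity>"
    have "?J (2 * C) t \<le> ennreal (2 * C)" if t: "0 < t" for t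
    proof -
      have fin: "\<beta> t < \<infinity>" using I t by blast
      note b = b[OF t fin]
      let ?k = "ennreal (enn2real (\<beta> t) / (2 * C))"
      have "?k * ?J (2 * C) t \<le> \<beta> t"
        using JI[OF C t fin] I t by (auto intro: order_trans)
      also have "\<dots> = ?k * ennreal (2 * C)"
        using b C by (simp flip: ennreal_mult')
      finally show ?thesis
        using b C by (subst (asm) ennreal_mult_le_mult_iff) (auto simp: ennreal_eq_0_iff not_le)
    qed
    then show "\<exists>C>0. \<forall>t>0. \<beta> t < \<infinity> \<and> ?J C t \<le> ennreal C"
      using C I by (intro exI[of _ "2 * C"]) auto
  next
    fix C :: real assume C: "0 < C" and Jb: "\<forall>t>0. \<beta> t < \<infinity> \<and> ?J C t \<le> ennreal C"
    have "?I C t \<le> \<beta> t" if t: "0 < t" for t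
    proof -
      have fin: "\<beta> t < \<infinity>" using Jb t by blast
      have "?I C t \<le> ennreal (enn2real (\<beta> t) / C) * ?J C t" by (rule IJ[OF C t fin])
      also have "\<dots> \<le> ennreal (enn2real (\<beta> t) / C) * ennreal C"
        using Jb t by (intro mult_left_mono) auto
      also have "\<dots> = \<beta> t" using b[OF t fin] C by (simp flip: ennreal_mult')
      finally show ?thesis .
    qed
    then show "\<exists>C>0. \<forall>t>0. ?I C t \<le> \<beta> t \<and> \<beta> t < \<infinity>"
      using C Jb by (intro exI[of _ C]) auto
  qed
qed

section \<open>From the modular inequality to the weak condition\<close>

text \<open>Test the inequality on \<open>f = \<Psi>\<^sub>2(u)/(K u)\<close> on \<open>A\<close>, where \<open>u(s) = s\<^sup>b\<close>. On the left, \<open>Q f\<close> is the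
  constant \<open>\<integral>\<^sub>A \<Psi>\<^sub>2(u) s\<^sup>\<gamma> ds / K\<close> times \<open>x\<^sup>-\<^sup>a\<close> to the left of \<open>A\<close>; on the right,
  \<open>\<Phi>\<^sub>2(K f) \<le> \<Psi>\<^sub>2(u)\<close>.\<close>
lemma weak_bound_on_set:
  fixes A :: "real set"
  assumes yd: "young_density \<phi>2" and mono1: "mono \<Phi>1" and K: "0 < K"
    and M: "\<And>f. f \<in> half_line_measurable \<Longrightarrow> \<forall>t>0. 0 \<le> f t \<Longrightarrow>
      modular \<Phi>1 \<gamma> (hardy_nonneg q (\<lambda>s. ennreal (f s))) \<le> modular (young \<phi>2) \<gamma> (\<lambda>s. ennreal (K * \<bar>f s\<bar>))"
    and A [measurable]: "A \<in> sets lebesgue" "A \<subseteq> {t<..}" and t: "0 < t"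
    and B: "B = (\<integral>\<^sup>+ s \<in> A. complementary \<phi>2 (ennreal (s powr (1 / q - 1 - \<gamma>))) * ennreal (s powr \<gamma>) \<partial>lebesgue)"
  shows "(\<integral>\<^sup>+ s \<in> {0<..<t}. \<Phi>1 (B / ennreal (K * s powr (1 / q))) * ennreal (s powr \<gamma>) \<partial>lebesgue) \<le> B"
proof -
  let ?b = "1 / q - 1 - \<gamma>" and ?\<Psi> = "complementary \<phi>2"
  define f where "f s = indicator A s * (enn2real (?\<Psi> (ennreal (s powr ?b))) / (K * s powr ?b))" for s
  have mono2: "mono ?\<Psi>" unfolding complementary_def by (rule mono_young)
  note [measurable] = mono_borel_measurable_ennreal[OF mono2]
  have "(\<lambda>s::real. ?\<Psi> (ennreal (s powr ?b))) \<in> borel_measurable lebesgue"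
    by (rule borel_imp_lebesgue_measurable) measurable
  moreover have "(\<lambda>s::real. enn2real (?\<Psi> (ennreal (s powr ?b))) / (K * s powr ?b)) \<in> borel_measurable lebesgue"
    by (rule borel_imp_lebesgue_measurable) measurable
  ultimately have [measurable]: "(\<lambda>s::real. ?\<Psi> (ennreal (s powr ?b))) \<in> borel_measurable lebesgue"
    "f \<in> borel_measurable lebesgue"
    unfolding f_def by measurable
  have fin: "?\<Psi> (ennreal x) = ennreal (enn2real (?\<Psi> (ennreal x)))" for x
    unfolding complementary_def using young_finite[OF mono_gen_inverse[OF yd], of x] by simp
  have fnn: "0 \<le> f s" for s using K by (simp add: f_def)
  have Q: "hardy_nonneg q (\<lambda>s. ennreal (f s)) x = B / ennreal (K * x powr (1 / q))" if x: "0 < x" "x < t" for x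
  proof -
    have "tail_integral (\<lambda>s. ennreal (f s) * ennreal (s powr (1 / q - 1))) x
        = (\<integral>\<^sup>+ s. ennreal (1 / K) * (?\<Psi> (ennreal (s powr ?b)) * ennreal (s powr \<gamma>) * indicator A s) \<partial>lebesgue)"
      unfolding tail_integral_def
    proof (rule nn_integral_cong)
      fix s
      show "ennreal (f s) * ennreal (s powr (1 / q - 1)) * indicator {x<..} s
          = ennreal (1 / K) * (?\<Psi> (ennreal (s powr ?b)) * ennreal (s powr \<gamma>) * indicator A s)"
      proof (cases "s \<in> A")
        case True
        then have s: "0 < s" "x < s" using A t x by auto
        have "f s * s powr (1 / q - 1) = 1 / K * (enn2real (?\<Psi> (ennreal (s powr ?b))) * s powr \<gamma>)"
          using True s K by (simp add: f_def powr_diff)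
        then have "ennreal (f s) * ennreal (s powr (1 / q - 1))
            = ennreal (1 / K) * (ennreal (enn2real (?\<Psi> (ennreal (s powr ?b)))) * ennreal (s powr \<gamma>))"
          using K fnn by (simp flip: ennreal_mult' ennreal_mult'')
        then show ?thesis using True s by (simp flip: fin)
      qed (simp add: f_def)
    qed
    also have "\<dots> = ennreal (1 / K) * B"
      unfolding B by (subst nn_integral_cmult) auto
    finally have "hardy_nonneg q (\<lambda>s. ennreal (f s)) x = ennreal (x powr - (1 / q)) * (ennreal (1 / K) * B)"
      by (simp add: hardy_nonneg_tail)
    also have "\<dots> = ennreal (1 / (K * x powr (1 / q))) * B"
    proof -
      have "ennreal (x powr - (1 / q)) * ennreal (1 / K) = ennreal (1 / (K * x powr (1 / q)))"
        using K by (simp add: powr_minus inverse_eq_divide mult_ac flip: ennreal_mult')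
      then show ?thesis by (simp only: mult.assoc[symmetric])
    qed
    finally show ?thesis using K x by (subst ennreal_divide_eq_mult) auto
  qed
  have "(\<integral>\<^sup>+ s \<in> {0<..<t}. \<Phi>1 (B / ennreal (K * s powr (1 / q))) * ennreal (s powr \<gamma>) \<partial>lebesgue)
     \<le> modular \<Phi>1 \<gamma> (hardy_nonneg q (\<lambda>s. ennreal (f s)))"
    unfolding modular_def by (intro nn_integral_mono) (auto simp: indicator_def Q)
  also have "\<dots> \<le> modular (young \<phi>2) \<gamma> (\<lambda>s. ennreal (K * \<bar>f s\<bar>))"
    using fnn by (intro M half_line_measurableI) auto
  also have "\<dots> \<le> B"
    unfolding modular_def B
  proof (intro nn_integral_mono)
    fix s
    show "young \<phi>2 (ennreal (K * \<bar>f s\<bar>)) * ennreal (s powr \<gamma>) * indicator {0<..} s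
        \<le> ?\<Psi> (ennreal (s powr ?b)) * ennreal (s powr \<gamma>) * indicator A s"
    proof (cases "s \<in> A")
      case True
      then have s: "0 < s" using A t by auto
      have "K * \<bar>f s\<bar> = enn2real (?\<Psi> (ennreal (s powr ?b))) / s powr ?b"
        using True K by (simp add: f_def abs_mult)
      then show ?thesis
        using True s young_complementary_quotient_le[OF yd, of "s powr ?b"]
        by (auto intro!: mult_right_mono)
    qed (simp add: f_def)
  qed
  finally show ?thesis .
qed

text \<open>That \<open>\<beta>(t)\<close> is finite follows by testing on bounded intervals \<open>(t, N)\<close>: there the integral
  \<open>B\<close> is finite and \<open>\<kappa> \<Phi>\<^sub>1(cB) \<le> B\<close> with \<open>\<kappa>\<close> and \<open>c\<close> independent of \<open>N\<close>, while \<open>\<Phi>\<^sub>1\<close> grows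
  faster than any linear function, so the values \<open>B\<close> stay bounded.\<close>
lemma hardy_beta_finite:
  assumes yd1: "young_density \<phi>1" and yd2: "young_density \<phi>2" and K: "0 < K" and t: "0 < t"
    and M: "\<And>f. f \<in> half_line_measurable \<Longrightarrow> \<forall>t>0. 0 \<le> f t \<Longrightarrow>
      modular (young \<phi>1) \<gamma> (hardy_nonneg q (\<lambda>s. ennreal (f s)))
        \<le> modular (young \<phi>2) \<gamma> (\<lambda>s. ennreal (K * \<bar>f s\<bar>))"
    and "0 < q"
  shows "hardy_beta q \<gamma> (complementary \<phi>2) t < \<infinity>"
proof -
  let ?b = "1 / q - 1 - \<gamma>" and ?\<Psi> = "complementary \<phi>2"
  let ?h = "\<lambda>s. ?\<Psi> (ennreal (s powr ?b)) * ennreal (s powr \<gamma>)"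
  have mono2: "mono ?\<Psi>" unfolding complementary_def by (rule mono_young)
  note [measurable] = mono_borel_measurable_ennreal[OF mono2]
  have [measurable]: "?h \<in> borel_measurable lebesgue"
    by (rule borel_imp_lebesgue_measurable) measurable
  define B where "B n = (\<integral>\<^sup>+ s \<in> {t<..<t + real n}. ?h s \<partial>lebesgue)" for n
  \<comment> \<open>\<open>\<kappa>\<close> bounds the integral of \<open>s\<^sup>\<gamma>\<close> over \<open>(t/2, t)\<close> from below, and \<open>T \<ge> K s\<^sup>a\<close> there\<close>
  define \<kappa> where "\<kappa> = min ((t / 2) powr \<gamma>) (t powr \<gamma>) * (t / 2)"
  define T where "T = K * t powr (1 / q)"
  have pos: "0 < \<kappa>" "0 < T" using t K by (auto simp: \<kappa>_def T_def)
  \<comment> \<open>with this slope, a value \<open>r \<ge> y0 T\<close> of \<open>B n\<close> would give \<open>2r \<le> \<kappa> \<Phi>\<^sub>1(r/T) \<le> r\<close>\<close>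
  obtain y0 where y0: "0 < y0" "\<And>y. y0 \<le> y \<Longrightarrow> ennreal (2 * T / \<kappa> * y) \<le> young \<phi>1 (ennreal y)"
    using young_density_superlinear[OF yd1, of "2 * T / \<kappa>"] pos by (metis less_imp_le divide_pos_pos mult_pos_pos zero_less_numeral)
  have Bfin: "B n < \<infinity>" for n
  proof -
    define m where "m r = max (t powr r) ((t + real n) powr r)" for r
    have "B n \<le> (\<integral>\<^sup>+ s. ?\<Psi> (ennreal (m ?b)) * ennreal (m \<gamma>) * indicator {t<..<t + real n} s \<partial>lebesgue)"
      unfolding B_def
    proof (intro nn_integral_mono)
      fix s
      have "?h s \<le> ?\<Psi> (ennreal (m ?b)) * ennreal (m \<gamma>)" if "t < s" "s < t + real n"
        using powr_between(2)[of t s "t + real n"] that t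
        unfolding complementary_def by (intro mult_mono young_mono ennreal_leI) (auto simp: m_def)
      then show "?h s * indicator {t<..<t + real n} s
         \<le> ?\<Psi> (ennreal (m ?b)) * ennreal (m \<gamma>) * indicator {t<..<t + real n} s"
        by (auto simp: indicator_def)
    qed
    also have "\<dots> = ?\<Psi> (ennreal (m ?b)) * ennreal (m \<gamma>) * ennreal (real n)"
      by (subst nn_integral_cmult_indicator) auto
    also have "\<dots> < \<infinity>"
      using young_finite[OF mono_gen_inverse[OF yd2], of "m ?b"]
      by (simp add: complementary_def ennreal_mult_less_top)
    finally show ?thesis .
  qed
  have Bbd: "B n \<le> ennreal (y0 * T)" for n
  proof (rule ccontr)
    assume "\<not> ?thesis"
    obtain r where r: "B n = ennreal r" "0 \<le> r" using Bfin[of n] by (cases "B n") auto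
    then have ry: "y0 * T < r" using \<open>\<not> B n \<le> ennreal (y0 * T)\<close> by (auto intro: ennreal_leI)
    then have rT: "y0 \<le> r / T" using pos by (simp add: field_simps)
    have "0 < r" using ry y0(1) pos by (auto intro: less_trans[rotated])
    have "ennreal (2 * r) = ennreal (2 * T / \<kappa> * (r / T)) * ennreal \<kappa>"
      using pos \<open>0 < r\<close> by (simp flip: ennreal_mult')
    also have "\<dots> \<le> young \<phi>1 (ennreal (r / T)) * ennreal \<kappa>"
      by (intro mult_right_mono y0 rT) simp
    also have "\<dots> = (\<integral>\<^sup>+ s. young \<phi>1 (ennreal (r / T)) * ennreal (min ((t / 2) powr \<gamma>) (t powr \<gamma>)) * indicator {t / 2<..<t} s \<partial>lebesgue)"
    proof -
      have "ennreal \<kappa> = ennreal (min ((t / 2) powr \<gamma>) (t powr \<gamma>)) * ennreal (t / 2)"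
        unfolding \<kappa>_def using t by (intro ennreal_mult) auto
      then show ?thesis
        using t by (subst nn_integral_cmult_indicator) (auto simp: mult.assoc)
    qed
    also have "\<dots> \<le> (\<integral>\<^sup>+ s \<in> {0<..<t}. young \<phi>1 (B n / ennreal (K * s powr (1 / q))) * ennreal (s powr \<gamma>) \<partial>lebesgue)"
    proof (intro nn_integral_mono)
      fix s
      have "young \<phi>1 (ennreal (r / T)) * ennreal (min ((t / 2) powr \<gamma>) (t powr \<gamma>))
          \<le> young \<phi>1 (B n / ennreal (K * s powr (1 / q))) * ennreal (s powr \<gamma>)" if s: "t / 2 < s" "s < t"
      proof (intro mult_mono young_mono ennreal_leI)
        have "s powr (1 / q) \<le> t powr (1 / q)" using s t \<open>0 < q\<close> by (intro powr_mono2) auto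
        then have "r / T \<le> r / (K * s powr (1 / q))"
          using s t K r by (auto simp: T_def intro!: divide_left_mono)
        then show "ennreal (r / T) \<le> B n / ennreal (K * s powr (1 / q))"
          using s t K r by (simp add: divide_ennreal ennreal_leI)
        show "min ((t / 2) powr \<gamma>) (t powr \<gamma>) \<le> s powr \<gamma>"
          using s t by (intro powr_between) auto
      qed auto
      then show "young \<phi>1 (ennreal (r / T)) * ennreal (min ((t / 2) powr \<gamma>) (t powr \<gamma>)) * indicator {t / 2<..<t} s
          \<le> young \<phi>1 (B n / ennreal (K * s powr (1 / q))) * ennreal (s powr \<gamma>) * indicator {0<..<t} s"
        using t by (auto simp: indicator_def)
    qed
    also have "\<dots> \<le> B n"
      by (rule weak_bound_on_set[OF yd2 mono_young K M _ _ t B_def]) auto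
    finally have "ennreal (2 * r) \<le> ennreal r" using r by simp
    then show False using \<open>0 < r\<close> by simp
  qed
  have "hardy_beta q \<gamma> ?\<Psi> t = (\<integral>\<^sup>+ s. (SUP n. ?h s * indicator {t<..<t + real n} s) \<partial>lebesgue)"
    unfolding hardy_beta_def
  proof (intro nn_integral_cong)
    fix s
    obtain N where N: "s - t < real N" using reals_Archimedean2 by blast
    show "?h s * indicator {t<..} s = (SUP n. ?h s * indicator {t<..<t + real n} s)"
    proof (rule antisym)
      show "?h s * indicator {t<..} s \<le> (SUP n. ?h s * indicator {t<..<t + real n} s)"
        using N by (intro SUP_upper2[of N]) (auto simp: indicator_def)
      show "(SUP n. ?h s * indicator {t<..<t + real n} s) \<le> ?h s * indicator {t<..} s"
        by (intro SUP_least) (auto simp: indicator_def)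
    qed
  qed
  also have "\<dots> = (SUP n. B n)"
    unfolding B_def
    by (intro nn_integral_monotone_convergence_SUP incseq_SucI le_funI)
      ((auto simp: indicator_def)[1], measurable)
  also have "\<dots> \<le> ennreal (y0 * T)" by (intro SUP_least Bbd)
  finally show ?thesis by (auto intro: le_less_trans)
qed

lemma weak_bound_of_modular_bound:
  assumes yd1: "young_density \<phi>1" and yd2: "young_density \<phi>2" and "0 < q"
    and M: "hardy_modular_bound q \<gamma> (young \<phi>1) (young \<phi>2)"
    and \<beta>: "\<beta> = hardy_beta q \<gamma> (complementary \<phi>2)"
  shows "\<exists>C>0. \<forall>t>0.
        (\<integral>\<^sup>+ s \<in> {0<..<t}. young \<phi>1 (\<beta> t / ennreal (C * s powr (1 / q))) * ennreal (s powr \<gamma>) \<partial>lebesgue)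
          \<le> \<beta> t \<and> \<beta> t < \<infinity>"
proof -
  obtain K where K: "0 < K" and M': "\<And>f. f \<in> half_line_measurable \<Longrightarrow> \<forall>t>0. 0 \<le> f t \<Longrightarrow>
      modular (young \<phi>1) \<gamma> (hardy_nonneg q (\<lambda>s. ennreal (f s)))
        \<le> modular (young \<phi>2) \<gamma> (\<lambda>s. ennreal (K * \<bar>f s\<bar>))"
    using M unfolding hardy_modular_bound_def by blast
  show ?thesis
  proof (intro exI[of _ K] conjI allI impI K)
    fix t :: real assume t: "0 < t"
    show "(\<integral>\<^sup>+ s \<in> {0<..<t}. young \<phi>1 (\<beta> t / ennreal (K * s powr (1 / q))) * ennreal (s powr \<gamma>) \<partial>lebesgue) \<le> \<beta> t"
      by (rule weak_bound_on_set[OF yd2 mono_young K M' _ _ t, of "{t<..}"]) (auto simp: \<beta> hardy_beta_def)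
    show "\<beta> t < \<infinity>"
      unfolding \<beta> by (rule hardy_beta_finite[OF yd1 yd2 K t M' \<open>0 < q\<close>])
  qed
qed

section \<open>From the weak condition to the modular inequality\<close>

text \<open>The parameter \<open>\<epsilon>\<close> is the freedom in Young's inequality for \<open>(K f)(\<epsilon> u)\<close>; it will be tuned to
  the size of \<open>f\<close> on each piece.\<close>
definition scaled_beta :: "real \<Rightarrow> real \<Rightarrow> (ennreal \<Rightarrow> ennreal) \<Rightarrow> real \<Rightarrow> real \<Rightarrow> ennreal" where
  "scaled_beta q \<gamma> \<Psi> \<epsilon> =
     tail_integral (\<lambda>s. \<Psi> (ennreal (\<epsilon> * s powr (1 / q - 1 - \<gamma>))) * ennreal (s powr \<gamma>))"

lemma scaled_beta_1: "scaled_beta q \<gamma> \<Psi> 1 t = hardy_beta q \<gamma> \<Psi> t"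
  by (simp add: scaled_beta_def hardy_beta_tail)

lemma complementary_powr_measurable [measurable]:
  "(\<lambda>s::real. complementary \<phi> (ennreal (\<epsilon> * s powr r))) \<in> borel_measurable lebesgue"
proof (rule borel_imp_lebesgue_measurable)
  note [measurable] = mono_borel_measurable_ennreal[OF mono_young, of "gen_inverse \<phi>", folded complementary_def]
  show "(\<lambda>s::real. complementary \<phi> (ennreal (\<epsilon> * s powr r))) \<in> borel_measurable borel" by measurable
qed

lemma hardy_beta_dilation:
  assumes c: "0 < c" and t: "0 < t"
  shows "hardy_beta q \<gamma> (complementary \<phi>) (c * t)
    = ennreal (c powr (\<gamma> + 1)) * scaled_beta q \<gamma> (complementary \<phi>) (c powr (1 / q - 1 - \<gamma>)) t"
proof -
  have "tail_integral (\<lambda>s. complementary \<phi> (ennreal ((c * s) powr (1 / q - 1 - \<gamma>))) * ennreal (s powr \<gamma>)) t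
      = scaled_beta q \<gamma> (complementary \<phi>) (c powr (1 / q - 1 - \<gamma>)) t"
    unfolding scaled_beta_def tail_integral_def using c t
    by (intro nn_integral_cong) (auto simp: indicator_def powr_mult)
  then show ?thesis
    unfolding hardy_beta_tail
    using complementary_powr_measurable[of \<phi> 1 "1 / q - 1 - \<gamma>"]
    by (subst tail_integral_dilation[OF _ c t]) simp_all
qed

lemma scaled_beta_scale:
  assumes yd: "young_density \<phi>" and k: "0 < k" "k \<le> 1"
  shows "scaled_beta q \<gamma> (complementary \<phi>) (k * \<epsilon>) t \<le> ennreal k * scaled_beta q \<gamma> (complementary \<phi>) \<epsilon> t"
proof -
  have "complementary \<phi> (ennreal (k * \<epsilon> * x)) \<le> ennreal k * complementary \<phi> (ennreal (\<epsilon> * x))" for x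
    using young_scale[OF mono_gen_inverse[OF yd] k, of "\<epsilon> * x"] by (simp add: complementary_def mult.assoc)
  then have "scaled_beta q \<gamma> (complementary \<phi>) (k * \<epsilon>) t
    \<le> (\<integral>\<^sup>+ s. ennreal k * (complementary \<phi> (ennreal (\<epsilon> * s powr (1 / q - 1 - \<gamma>))) * ennreal (s powr \<gamma>) * indicator {t<..} s) \<partial>lebesgue)"
    unfolding scaled_beta_def tail_integral_def
    by (intro nn_integral_mono) (auto simp: indicator_def mult.assoc[symmetric] intro!: mult_right_mono)
  also have "\<dots> = ennreal k * scaled_beta q \<gamma> (complementary \<phi>) \<epsilon> t"
    unfolding scaled_beta_def tail_integral_def by (subst nn_integral_cmult) auto
  finally show ?thesis .
qed

text \<open>If the exponent were \<open>0\<close>, then \<open>\<gamma> + 1 = 1/q > 0\<close> and \<open>\<beta>(2t) = 2\<^sup>\<gamma>\<^sup>+\<^sup>1 \<beta>(t) > \<beta>(t)\<close>, although \<open>\<beta>\<close>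
  is nonincreasing.\<close>
lemma exponent_nonzero:
  assumes "0 < q" and yd: "young_density \<phi>" and fin: "hardy_beta q \<gamma> (complementary \<phi>) 1 < \<infinity>"
  shows "1 / q - 1 - \<gamma> \<noteq> 0"
proof
  let ?\<beta> = "hardy_beta q \<gamma> (complementary \<phi>)"
  assume 0: "1 / q - 1 - \<gamma> = 0"
  moreover have "0 < 1 / q" using \<open>0 < q\<close> by simp
  ultimately have "0 < \<gamma> + 1" by linarith
  obtain r where r: "?\<beta> 1 = ennreal r" "0 < r"
    using fin hardy_beta_pos[OF yd, of 1 q \<gamma>] by (cases "?\<beta> 1") auto
  have "?\<beta> (2 * 1) = ennreal (2 powr (\<gamma> + 1)) * ?\<beta> 1"
    using hardy_beta_dilation[of 2 1 q \<gamma> \<phi>] 0 by (simp add: scaled_beta_1)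
  also have "\<dots> = ennreal (2 powr (\<gamma> + 1) * r)" using r by (simp add: ennreal_mult')
  finally have "?\<beta> 2 = ennreal (2 powr (\<gamma> + 1) * r)" by simp
  moreover have "?\<beta> 2 \<le> ?\<beta> 1"
    unfolding hardy_beta_tail by (rule tail_integral_antimono) simp
  ultimately have "ennreal (2 powr (\<gamma> + 1) * r) \<le> ennreal r" using r(1) by simp
  then have "2 powr (\<gamma> + 1) * r \<le> r" using r by simp
  then have "2 powr (\<gamma> + 1) \<le> 1" using r by simp
  moreover have "(1::real) < 2 powr (\<gamma> + 1)" using \<open>0 < \<gamma> + 1\<close> by simp
  ultimately show False by simp
qed

text \<open>By dilation, \<open>\<epsilon> = c\<^sup>b\<close> turns \<open>scaled_beta\<close> at \<open>t\<close> into a multiple of \<open>\<beta>(ct)\<close>. This gives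
  continuity in \<open>c\<close>; that all positive values are attained then follows from
  \<open>\<Psi>\<^sub>2(k x) \<le> k \<Psi>\<^sub>2(x)\<close> for \<open>k \<le> 1\<close>.\<close>
lemma scaled_beta_attains:
  assumes "0 < q" and yd: "young_density \<phi>" and t: "0 < t" and r: "0 < r"
    and fin: "\<And>t. 0 < t \<Longrightarrow> hardy_beta q \<gamma> (complementary \<phi>) t < \<infinity>"
  obtains c where "0 < c" "scaled_beta q \<gamma> (complementary \<phi>) (c powr (1 / q - 1 - \<gamma>)) t = ennreal r"
proof -
  let ?\<beta> = "hardy_beta q \<gamma> (complementary \<phi>)" and ?b = "1 / q - 1 - \<gamma>"
  let ?S = "\<lambda>\<epsilon>. scaled_beta q \<gamma> (complementary \<phi>) \<epsilon> t"
  have b: "?b \<noteq> 0" by (rule exponent_nonzero[OF \<open>0 < q\<close> yd fin]) simp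
  define H where "H c = ?S (c powr ?b)" for c
  have H: "H c = ennreal (c powr (- (\<gamma> + 1))) * ?\<beta> (c * t)" if c: "0 < c" for c
  proof -
    have "ennreal (c powr (- (\<gamma> + 1))) * ?\<beta> (c * t)
        = ennreal (c powr (- (\<gamma> + 1)) * c powr (\<gamma> + 1)) * H c"
      unfolding hardy_beta_dilation[OF c t] H_def by (simp only: ennreal_mult' powr_ge_zero mult.assoc)
    also have "c powr (- (\<gamma> + 1)) * c powr (\<gamma> + 1) = 1"
      using c by (simp flip: powr_add)
    finally show ?thesis by simp
  qed
  have fin': "?\<beta> (c * t) \<noteq> top" if "0 < c" for c
    using fin[of "c * t"] that t by auto
  have "continuous_on {0<..} ?\<beta>"
    unfolding hardy_beta_tail[abs_def] using fin complementary_powr_measurable[of \<phi> 1 ?b]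
    by (intro continuous_on_tail_integral) (auto simp: hardy_beta_tail)
  then have "continuous_on {0<..} (\<lambda>c. ?\<beta> (c * t))"
    by (rule continuous_on_compose2) (use t in \<open>auto intro!: continuous_intros\<close>)
  then have "continuous_on {0<..} (\<lambda>c. c powr (- (\<gamma> + 1)) * enn2real (?\<beta> (c * t)))"
    unfolding continuous_on_def using fin'
    by (auto intro!: tendsto_intros simp: ennreal_enn2real less_top)
  moreover have "enn2real (H c) = c powr (- (\<gamma> + 1)) * enn2real (?\<beta> (c * t))" if "0 < c" for c
    using that by (simp add: H enn2real_mult)
  ultimately have contH: "continuous_on {0<..} (\<lambda>c. enn2real (H c))"
    by (subst continuous_on_cong[OF refl]) auto
  have Hfin: "ennreal (enn2real (H c)) = H c" if "0 < c" for c
    using fin'[OF that] by (simp add: H[OF that] ennreal_mult_less_top less_top)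
  have solve: "\<exists>c>0. H c = ?S k" if "0 < k" for k
  proof -
    have "(k powr (1 / ?b)) powr ?b = k"
      using b that by (simp add: powr_powr)
    then show ?thesis unfolding H_def using that by (intro exI[of _ "k powr (1 / ?b)"] conjI) (simp_all only: powr_gt_zero)
  qed
  obtain v where v: "?S 1 = ennreal v" "0 < v"
    using fin[OF t] hardy_beta_pos[OF yd t, of q \<gamma>] unfolding scaled_beta_1
    by (cases "?\<beta> t") auto
  obtain c0 where c0: "0 < c0" "enn2real (H c0) \<le> r"
  proof -
    let ?k = "min 1 (r / v)"
    have k: "0 < ?k" "?k \<le> 1" using r v by auto
    have "?S (?k * 1) \<le> ennreal ?k * ?S 1" by (rule scaled_beta_scale[OF yd k])
    also have "\<dots> = ennreal (?k * v)" using k v by (simp add: ennreal_mult')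
    also have "\<dots> \<le> ennreal r"
      using mult_right_mono[of ?k "r / v" v] v by (intro ennreal_leI) simp
    finally have Sk: "?S ?k \<le> ennreal r" by simp
    obtain c where c: "0 < c" "H c = ?S ?k" using solve[OF k(1)] by blast
    have "H c \<le> ennreal r" using Sk c(2) by simp
    then have "ennreal (enn2real (H c)) \<le> ennreal r" by (simp only: Hfin[OF c(1)])
    then show thesis using that[OF c(1)] r by simp
  qed
  obtain c1 where c1: "0 < c1" "r \<le> enn2real (H c1)"
  proof -
    define k where "k = min 1 (v / r)"
    have k: "0 < k" "k \<le> 1" "k \<le> v / r" using r v by (auto simp: k_def)
    obtain c where c: "0 < c" "H c = ?S (1 / k)" using solve[of "1 / k"] k(1) by auto
    define w where "w = enn2real (H c)"
    have w: "?S (1 / k) = ennreal w" "0 \<le> w"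
      unfolding c(2)[symmetric] w_def Hfin[OF c(1)] by simp_all
    have "ennreal v \<le> ennreal k * ?S (1 / k)"
      using scaled_beta_scale[OF yd k(1,2), of q \<gamma> "1 / k" t] k(1) v(1) by simp
    then have "ennreal v \<le> ennreal (k * w)"
      unfolding w(1) using k(1) by (simp add: ennreal_mult')
    then have "v \<le> k * w" using k(1) w(2) by (subst (asm) ennreal_le_iff) auto
    also have "\<dots> \<le> (v / r) * w" using w(2) k(3) by (rule mult_right_mono[rotated])
    finally have "r \<le> w" using v(2) r by (simp add: field_simps)
    then show thesis using that[OF c(1)] by (simp only: w_def)
  qed
  have conn: "connected ((\<lambda>c. enn2real (H c)) ` {0<..})"
    by (intro connected_continuous_image contH) simp
  have "r \<in> (\<lambda>c. enn2real (H c)) ` {0<..}"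
    using c0(1) c1(1) by (intro connectedD_interval[OF conn imageI imageI c0(2) c1(2)]) simp_all
  then obtain c where c: "0 < c" "enn2real (H c) = r" by blast
  have "H c = ennreal r" using Hfin[OF c(1)] by (simp only: c(2))
  then have "?S (c powr ?b) = ennreal r" by (simp only: H_def)
  then show thesis using that[OF c(1)] by blast
qed

text \<open>The weak condition at the point \<open>ct\<close>, transported to \<open>t\<close> by dilation, is the weak condition
  at \<open>t\<close> with parameter \<open>\<epsilon> = c\<^sup>b\<close>.\<close>
lemma weak_bound_scaled:
  assumes mono1: "mono \<Phi>1" and zero: "\<Phi>1 0 = 0" and C: "0 < C" and c: "0 < c" and t: "0 < t"
    and fin: "hardy_beta q \<gamma> (complementary \<phi>) (c * t) < \<infinity>"
    and weak: "(\<integral>\<^sup>+ s \<in> {0<..<c * t}. \<Phi>1 (hardy_beta q \<gamma> (complementary \<phi>) (c * t) / ennreal (C * s powr (1 / q)))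
        * ennreal (s powr \<gamma>) \<partial>lebesgue) \<le> hardy_beta q \<gamma> (complementary \<phi>) (c * t)"
    and \<epsilon>: "\<epsilon> = c powr (1 / q - 1 - \<gamma>)"
    and r: "scaled_beta q \<gamma> (complementary \<phi>) \<epsilon> t = ennreal r" "0 \<le> r"
  shows "(\<integral>\<^sup>+ s \<in> {0<..<t}. \<Phi>1 (ennreal (r / (C * \<epsilon> * s powr (1 / q)))) * ennreal (s powr \<gamma>) \<partial>lebesgue) \<le> ennreal r"
proof -
  let ?B = "hardy_beta q \<gamma> (complementary \<phi>) (c * t)"
  have B: "?B = ennreal (c powr (\<gamma> + 1) * r)"
    unfolding hardy_beta_dilation[OF c t] using r \<epsilon> by (simp add: ennreal_mult')
  \<comment> \<open>the indicator makes the integral over \<open>(0, ct)\<close> a modular, as \<open>\<Phi>\<^sub>1(0) = 0\<close>\<close>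
  define F where "F s = ennreal (c powr (\<gamma> + 1) * r / (C * s powr (1 / q))) * indicator {0<..<c * t} s" for s
  have [measurable]: "F \<in> borel_measurable lebesgue"
    unfolding F_def by (rule borel_imp_lebesgue_measurable) measurable
  have "ennreal (c powr (\<gamma> + 1)) * modular \<Phi>1 \<gamma> (\<lambda>s. F (c * s)) = modular \<Phi>1 \<gamma> F"
    by (rule modular_dilation[OF mono1 _ c, symmetric]) simp
  also have "\<dots> = (\<integral>\<^sup>+ s \<in> {0<..<c * t}. \<Phi>1 (?B / ennreal (C * s powr (1 / q))) * ennreal (s powr \<gamma>) \<partial>lebesgue)"
    unfolding modular_def B F_def using C r(2)
    by (intro nn_integral_cong) (auto simp: indicator_def divide_ennreal zero)
  also have "\<dots> \<le> ennreal (c powr (\<gamma> + 1)) * ennreal r"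
    using weak r(2) unfolding B by (simp add: ennreal_mult')
  finally have bound: "modular \<Phi>1 \<gamma> (\<lambda>s. F (c * s)) \<le> ennreal r"
    using c by (subst (asm) ennreal_mult_le_mult_iff) auto
  have "F (c * s) = ennreal (r / (C * \<epsilon> * s powr (1 / q)))" if "0 < s" "s < t" for s
  proof -
    have "c powr (\<gamma> + 1) = c powr (1 / q) / \<epsilon>"
      unfolding \<epsilon> using c by (simp add: add.commute flip: powr_diff)
    then have "c powr (\<gamma> + 1) * r / (C * (c * s) powr (1 / q)) = r / (C * \<epsilon> * s powr (1 / q))"
      using c that by (simp add: powr_mult)
    then show ?thesis using that c by (simp add: F_def)
  qed
  then have "(\<integral>\<^sup>+ s \<in> {0<..<t}. \<Phi>1 (ennreal (r / (C * \<epsilon> * s powr (1 / q)))) * ennreal (s powr \<gamma>) \<partial>lebesgue)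
      \<le> modular \<Phi>1 \<gamma> (\<lambda>s. F (c * s))"
    unfolding modular_def by (intro nn_integral_mono) (auto simp: indicator_def)
  with bound show ?thesis by (rule order_trans[rotated])
qed

text \<open>Integrate Young's inequality for the product of \<open>K f(s)\<close> and \<open>\<epsilon> s\<^sup>b\<close>, using
  \<open>s\<^sup>a\<^sup>-\<^sup>1 = s\<^sup>b s\<^sup>\<gamma>\<close>.\<close>
lemma tail_young:
  assumes yd: "young_density \<phi>" and [measurable]: "f \<in> borel_measurable lebesgue" and fnn: "\<And>s. 0 \<le> f s"
    and J [measurable]: "J \<in> sets lebesgue" "J \<subseteq> {t<..}" and pos: "0 < t" "0 < K" "0 < \<epsilon>"
  shows "ennreal (K * \<epsilon>) * (\<integral>\<^sup>+ s \<in> J. ennreal (f s) * ennreal (s powr (1 / q - 1)) \<partial>lebesgue)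
    \<le> (\<integral>\<^sup>+ s \<in> J. young \<phi> (ennreal (K * f s)) * ennreal (s powr \<gamma>) \<partial>lebesgue)
      + scaled_beta q \<gamma> (complementary \<phi>) \<epsilon> t"
proof -
  let ?b = "1 / q - 1 - \<gamma>"
  note [measurable] = mono_borel_measurable_ennreal[OF mono_young, of \<phi>]
  have "ennreal (K * \<epsilon>) * (\<integral>\<^sup>+ s \<in> J. ennreal (f s) * ennreal (s powr (1 / q - 1)) \<partial>lebesgue)
    = (\<integral>\<^sup>+ s. ennreal (K * \<epsilon>) * (ennreal (f s) * ennreal (s powr (1 / q - 1)) * indicator J s) \<partial>lebesgue)"
    by (subst nn_integral_cmult) auto
  also have "\<dots> \<le> (\<integral>\<^sup>+ s. young \<phi> (ennreal (K * f s)) * ennreal (s powr \<gamma>) * indicator J s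
      + complementary \<phi> (ennreal (\<epsilon> * s powr ?b)) * ennreal (s powr \<gamma>) * indicator {t<..} s \<partial>lebesgue)"
  proof (intro nn_integral_mono)
    fix s
    have "ennreal (K * \<epsilon>) * (ennreal (f s) * ennreal (s powr (1 / q - 1)))
        \<le> young \<phi> (ennreal (K * f s)) * ennreal (s powr \<gamma>)
          + complementary \<phi> (ennreal (\<epsilon> * s powr ?b)) * ennreal (s powr \<gamma>)" if s: "0 < s"
    proof -
      have "K * \<epsilon> * (f s * s powr (1 / q - 1)) = (K * f s) * (\<epsilon> * s powr ?b) * s powr \<gamma>"
        using s by (simp add: mult_ac flip: powr_add)
      then have "ennreal (K * \<epsilon>) * (ennreal (f s) * ennreal (s powr (1 / q - 1)))
          = ennreal ((K * f s) * (\<epsilon> * s powr ?b)) * ennreal (s powr \<gamma>)"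
        using pos fnn by (simp flip: ennreal_mult' ennreal_mult'')
      also have "\<dots> \<le> (young \<phi> (ennreal (K * f s)) + complementary \<phi> (ennreal (\<epsilon> * s powr ?b))) * ennreal (s powr \<gamma>)"
        using pos fnn by (intro mult_right_mono young_inequality yd) auto
      finally show ?thesis by (simp add: distrib_right)
    qed
    then show "ennreal (K * \<epsilon>) * (ennreal (f s) * ennreal (s powr (1 / q - 1)) * indicator J s)
        \<le> young \<phi> (ennreal (K * f s)) * ennreal (s powr \<gamma>) * indicator J s
          + complementary \<phi> (ennreal (\<epsilon> * s powr ?b)) * ennreal (s powr \<gamma>) * indicator {t<..} s"
      using J(2) pos by (auto simp: indicator_def)
  qed
  also have "\<dots> = (\<integral>\<^sup>+ s \<in> J. young \<phi> (ennreal (K * f s)) * ennreal (s powr \<gamma>) \<partial>lebesgue)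
      + scaled_beta q \<gamma> (complementary \<phi>) \<epsilon> t"
    unfolding scaled_beta_def tail_integral_def by (subst nn_integral_add) auto
  finally show ?thesis .
qed

text \<open>Let \<open>B\<close> be the right-hand side. Young's inequality bounds \<open>8 C \<epsilon> A\<close> by \<open>B\<close> plus the scaled
  \<open>\<beta>\<close> at \<open>t\<close>. For \<open>\<epsilon>\<close> chosen such that the latter equals a given \<open>r > B\<close>, the sum is at most
  \<open>2r\<close>, so \<open>4A \<le> r/(C\<epsilon>)\<close>, and the weak condition with parameter \<open>\<epsilon>\<close> bounds the left-hand side
  by \<open>r\<close>. Taking \<open>r > B\<close> instead of \<open>r = B\<close> covers \<open>B = 0\<close>, a value that the scaled \<open>\<beta>\<close> does
  not take.\<close>
lemma modular_bound_on_piece: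
  assumes "0 < q" and yd: "young_density \<phi>" and mono1: "mono \<Phi>1" and zero: "\<Phi>1 0 = 0"
    and C: "0 < C" and t: "0 < t"
    and fin: "\<And>t. 0 < t \<Longrightarrow> hardy_beta q \<gamma> (complementary \<phi>) t < \<infinity>"
    and weak: "\<And>t. 0 < t \<Longrightarrow> (\<integral>\<^sup>+ s \<in> {0<..<t}. \<Phi>1 (hardy_beta q \<gamma> (complementary \<phi>) t / ennreal (C * s powr (1 / q)))
        * ennreal (s powr \<gamma>) \<partial>lebesgue) \<le> hardy_beta q \<gamma> (complementary \<phi>) t"
    and f [measurable]: "f \<in> borel_measurable lebesgue" and fnn: "\<And>s. 0 \<le> f s"
    and J [measurable]: "J \<in> sets lebesgue" "J \<subseteq> {t<..}"
    and A: "A = (\<integral>\<^sup>+ s \<in> J. ennreal (f s) * ennreal (s powr (1 / q - 1)) \<partial>lebesgue)"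
  shows "(\<integral>\<^sup>+ x \<in> {0<..<t}. \<Phi>1 (ennreal (x powr (- (1 / q))) * (4 * A)) * ennreal (x powr \<gamma>) \<partial>lebesgue)
    \<le> (\<integral>\<^sup>+ s \<in> J. young \<phi> (ennreal (8 * C * f s)) * ennreal (s powr \<gamma>) \<partial>lebesgue)"
    (is "?lhs \<le> ?B")
proof (rule dense_ge)
  fix B' assume B': "?B < B'"
  show "?lhs \<le> B'"
  proof (cases B')
    case (real r)
    with B' have r: "0 < r" by (cases "r = 0") auto
    obtain c where c: "0 < c" "scaled_beta q \<gamma> (complementary \<phi>) (c powr (1 / q - 1 - \<gamma>)) t = ennreal r"
      using scaled_beta_attains[OF \<open>0 < q\<close> yd t r fin] by blast
    define \<epsilon> where "\<epsilon> = c powr (1 / q - 1 - \<gamma>)"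
    have \<epsilon>: "0 < \<epsilon>" using c by (simp add: \<epsilon>_def)
    have C8: "0 < 8 * C" using C by simp
    have "ennreal (8 * C * \<epsilon>) * A \<le> ?B + ennreal r"
      using tail_young[OF yd f fnn J t C8 \<epsilon>, where q = q and \<gamma> = \<gamma>] c(2) by (simp add: A \<epsilon>_def)
    also have "\<dots> \<le> ennreal r + ennreal r" using B' real by (intro add_right_mono) auto
    also have "\<dots> = ennreal (2 * r)" using r by (simp flip: ennreal_plus)
    finally have le: "ennreal (8 * C * \<epsilon>) * A \<le> ennreal (2 * r)" .
    then have "A \<noteq> top" using C \<epsilon> by (auto simp: ennreal_mult_top top_unique)
    then obtain a where a: "A = ennreal a" "0 \<le> a" by (cases A) auto
    have "ennreal (8 * C * \<epsilon> * a) \<le> ennreal (2 * r)"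
      using le C \<epsilon> a by (simp add: ennreal_mult')
    then have "8 * C * \<epsilon> * a \<le> 2 * r" using r by simp
    then have a4: "4 * a \<le> r / (C * \<epsilon>)" using C \<epsilon> by (simp add: field_simps)
    have A4: "4 * A = ennreal (4 * a)" using a by (simp add: ennreal_mult')
    have "?lhs \<le> (\<integral>\<^sup>+ s \<in> {0<..<t}. \<Phi>1 (ennreal (r / (C * \<epsilon> * s powr (1 / q)))) * ennreal (s powr \<gamma>) \<partial>lebesgue)"
    proof (intro nn_integral_mono)
      fix x :: real
      have "ennreal (x powr (- (1 / q))) * (4 * A) \<le> ennreal (r / (C * \<epsilon> * x powr (1 / q)))" if "0 < x"
      proof -
        have "x powr (- (1 / q)) * (4 * a) \<le> x powr (- (1 / q)) * (r / (C * \<epsilon>))"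
          using a4 by (intro mult_left_mono) auto
        also have "\<dots> = r / (C * \<epsilon> * x powr (1 / q))" by (simp add: powr_minus field_simps)
        finally show ?thesis unfolding A4 by (simp add: ennreal_leI flip: ennreal_mult')
      qed
      then show "\<Phi>1 (ennreal (x powr (- (1 / q))) * (4 * A)) * ennreal (x powr \<gamma>) * indicator {0<..<t} x
          \<le> \<Phi>1 (ennreal (r / (C * \<epsilon> * x powr (1 / q)))) * ennreal (x powr \<gamma>) * indicator {0<..<t} x"
        by (auto simp: indicator_def intro!: mult_right_mono monoD[OF mono1])
    qed
    also have "\<dots> \<le> ennreal r"
      using c t r
      by (intro weak_bound_scaled[OF mono1 zero C c(1) t fin weak \<epsilon>_def]) (auto simp: \<epsilon>_def)
    finally show ?thesis using real by simp
  qed simp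
qed

definition dyadic_level :: "(real \<Rightarrow> ennreal) \<Rightarrow> int \<Rightarrow> real set" where
  "dyadic_level F k =
     {x. 0 < x \<and> ennreal (2 powr real_of_int k) < F x \<and> F x \<le> ennreal (2 powr (real_of_int k + 1))}"

lemma dyadic_level_exists:
  assumes "0 < y" "y < top"
  shows "\<exists>k::int. ennreal (2 powr real_of_int k) < y \<and> y \<le> ennreal (2 powr (real_of_int k + 1))"
proof -
  obtain r where r: "y = ennreal r" "0 < r" using assms by (cases y) auto
  define k where "k = \<lceil>log 2 r\<rceil> - 1"
  have "real_of_int k < log 2 r" "log 2 r \<le> real_of_int k + 1"
    unfolding k_def by linarith+
  then have "2 powr real_of_int k < r" "r \<le> 2 powr (real_of_int k + 1)"
    using r by (auto simp: less_log_iff log_le_iff)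
  then show ?thesis using r by (intro exI[of _ k]) (auto simp: ennreal_less_iff intro: ennreal_leI)
qed

lemma dyadic_level_disjoint: "k \<noteq> l \<Longrightarrow> dyadic_level F k \<inter> dyadic_level F l = {}"
proof (induction k l rule: linorder_wlog)
  case (le k l)
  then have "ennreal (2 powr (real_of_int k + 1)) \<le> ennreal (2 powr real_of_int l)"
    by (intro ennreal_leI powr_mono) auto
  moreover have "\<not> (F x \<le> ennreal (2 powr (real_of_int k + 1)) \<and> ennreal (2 powr real_of_int l) < F x)"
    if "ennreal (2 powr (real_of_int k + 1)) \<le> ennreal (2 powr real_of_int l)" for x
    using that by (meson leD order_trans)
  ultimately show ?case unfolding dyadic_level_def by blast
qed (auto simp: Int_commute)

text \<open>Write \<open>F(x) = \<integral>\<^sub>x\<^sup>\<infinity> f s\<^sup>a\<^sup>-\<^sup>1 ds\<close>. Let \<open>F(u) = 2\<^sup>k\<close> and let \<open>v\<close> be the first point after \<open>u\<close>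
  where \<open>F\<close> has come down to \<open>2\<^sup>k\<^sup>-\<^sup>1\<close>. The level \<open>k\<close> lies to the left of \<open>u\<close>, the interval \<open>(u, v)\<close> lies in
  the level \<open>k - 1\<close>, and the integral over it is at least \<open>2\<^sup>k\<^sup>-\<^sup>1\<close>, a quarter of the upper bound
  \<open>2\<^sup>k\<^sup>+\<^sup>1\<close> of \<open>F\<close> on the level \<open>k\<close>. So the level \<open>k\<close> on the left is controlled by the level \<open>k - 1\<close> on the right.\<close>
lemma modular_bound_on_level:
  assumes "0 < q" and yd: "young_density \<phi>" and mono1: "mono \<Phi>1" and zero: "\<Phi>1 0 = 0"
    and C: "0 < C"
    and fin: "\<And>t. 0 < t \<Longrightarrow> hardy_beta q \<gamma> (complementary \<phi>) t < \<infinity>"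
    and weak: "\<And>t. 0 < t \<Longrightarrow> (\<integral>\<^sup>+ s \<in> {0<..<t}. \<Phi>1 (hardy_beta q \<gamma> (complementary \<phi>) t / ennreal (C * s powr (1 / q)))
        * ennreal (s powr \<gamma>) \<partial>lebesgue) \<le> hardy_beta q \<gamma> (complementary \<phi>) t"
    and f [measurable]: "f \<in> borel_measurable lebesgue" and fnn: "\<And>s. 0 \<le> f s"
    and F: "F = tail_integral (\<lambda>s. ennreal (f s) * ennreal (s powr (1 / q - 1)))"
    and Ffin: "\<And>t. 0 < t \<Longrightarrow> F t < \<infinity>"
  shows "(\<integral>\<^sup>+ x \<in> dyadic_level F k. \<Phi>1 (ennreal (x powr (- (1 / q))) * F x) * ennreal (x powr \<gamma>) \<partial>lebesgue)
    \<le> (\<integral>\<^sup>+ s \<in> dyadic_level F (k - 1). young \<phi> (ennreal (8 * C * f s)) * ennreal (s powr \<gamma>) \<partial>lebesgue)"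
    (is "?lhs \<le> ?rhs")
proof (cases "dyadic_level F k = {}")
  case False
  then obtain x where x: "0 < x" "ennreal (2 powr real_of_int k) < F x"
    by (auto simp: dyadic_level_def)
  let ?h = "\<lambda>s. ennreal (f s) * ennreal (s powr (1 / q - 1))"
  let ?p = "2 powr real_of_int (k - 1)"
  have p2: "2 powr real_of_int k = 2 * ?p" "2 powr (real_of_int k + 1) = 4 * ?p"
    using powr_add[of 2 "real_of_int (k - 1)" 1] powr_add[of 2 "real_of_int (k - 1)" 2] by (simp_all add: add.commute)
  have h: "?h \<in> borel_measurable lebesgue" by measurable
  have cont: "continuous_on {0<..} F"
    unfolding F using Ffin by (intro continuous_on_tail_integral h) (simp add: F)
  have antimono: "F t' \<le> F t" if "t \<le> t'" for t t'
    unfolding F by (rule tail_integral_antimono[OF that])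
  have "(\<lambda>n. F (x + real n)) \<longlonglongrightarrow> 0"
    unfolding F using Ffin[OF x(1)] by (intro tail_integral_tendsto_0 h) (simp add: F)
  then have "eventually (\<lambda>n. F (x + real n) < ennreal ?p) sequentially"
    by (rule order_tendstoD) simp
  then obtain n where n: "F (x + real n) < ennreal ?p" by (auto simp: eventually_sequentially)
  have "\<exists>u\<ge>x. u \<le> x + real n \<and> F u = ennreal (2 powr real_of_int k)"
  proof (rule IVT2')
    show "F (x + real n) \<le> ennreal (2 powr real_of_int k)"
      using n by (rule order_trans[OF less_imp_le]) (simp add: p2)
    show "continuous_on {x..x + real n} F"
      by (rule continuous_on_subset[OF cont]) (use x in auto)
  qed (use x in auto)
  then obtain u where u: "x \<le> u" "u \<le> x + real n" "F u = ennreal (2 * ?p)" by (auto simp: p2)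
  then have u0: "0 < u" using x by simp
  \<comment> \<open>\<open>v\<close> must be the least point of this set, so that \<open>F > 2\<^sup>k\<^sup>-\<^sup>1\<close> on all of \<open>(u, v)\<close>\<close>
  define S where "S = {u..x + real n} \<inter> F -` {..ennreal ?p}"
  have "closed S"
    unfolding S_def using u0
    by (intro continuous_closed_preimage continuous_on_subset[OF cont]) auto
  moreover have "bounded S" by (rule bounded_subset[of "{u..x + real n}"]) (auto simp: S_def)
  ultimately have "compact S" by (simp add: compact_eq_bounded_closed)
  moreover have "x + real n \<in> S" using u n by (auto simp: S_def)
  ultimately obtain v where v: "v \<in> S" "\<And>s. s \<in> S \<Longrightarrow> v \<le> s"
    using compact_attains_inf[of S] by blast
  have uv: "u \<le> v" "F v \<le> ennreal ?p" "v \<le> x + real n" using v(1) by (auto simp: S_def)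
  let ?J = "{u<..<v}"
  have JF: "?J \<subseteq> dyadic_level F (k - 1)"
  proof
    fix s assume s: "s \<in> ?J"
    then have "s \<notin> S" using v(2) by force
    then have "ennreal ?p < F s" using s uv by (auto simp: S_def)
    moreover have "F s \<le> ennreal (2 powr (real_of_int (k - 1) + 1))"
      using antimono[of u s] s u(3) p2(1) by simp
    ultimately show "s \<in> dyadic_level F (k - 1)" using s u0 by (simp add: dyadic_level_def)
  qed
  define A where "A = (\<integral>\<^sup>+ s \<in> ?J. ?h s \<partial>lebesgue)"
  have "ennreal (2 * ?p) = A + F v"
    using tail_integral_split[OF h uv(1)] u(3) by (simp add: F A_def)
  also have "\<dots> \<le> A + ennreal ?p" by (intro add_left_mono uv)
  finally have "ennreal ?p + ennreal ?p \<le> A + ennreal ?p" by (simp flip: ennreal_plus)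
  then have A: "ennreal ?p \<le> A" by (simp add: ennreal_add_left_cancel_le add.commute)
  have "?lhs \<le> (\<integral>\<^sup>+ x \<in> {0<..<u}. \<Phi>1 (ennreal (x powr (- (1 / q))) * (4 * A)) * ennreal (x powr \<gamma>) \<partial>lebesgue)"
  proof (intro nn_integral_mono)
    fix y
    have "y < u \<and> F y \<le> 4 * A" if y: "y \<in> dyadic_level F k"
    proof
      have "F u < F y" using y u(3) p2 by (simp add: dyadic_level_def)
      then show "y < u" using antimono[of u y] by (meson leD not_le)
      have "F y \<le> 4 * ennreal ?p" using y p2 by (simp add: dyadic_level_def ennreal_mult')
      also have "\<dots> \<le> 4 * A" by (intro mult_left_mono A) simp
      finally show "F y \<le> 4 * A" .
    qed
    then show "\<Phi>1 (ennreal (y powr (- (1 / q))) * F y) * ennreal (y powr \<gamma>) * indicator (dyadic_level F k) y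
       \<le> \<Phi>1 (ennreal (y powr (- (1 / q))) * (4 * A)) * ennreal (y powr \<gamma>) * indicator {0<..<u} y"
      by (auto simp: indicator_def dyadic_level_def intro!: mult_right_mono mult_left_mono monoD[OF mono1])
  qed
  also have "\<dots> \<le> (\<integral>\<^sup>+ s \<in> ?J. young \<phi> (ennreal (8 * C * f s)) * ennreal (s powr \<gamma>) \<partial>lebesgue)"
    by (rule modular_bound_on_piece[OF \<open>0 < q\<close> yd mono1 zero C u0 fin weak f fnn _ _ A_def]) auto
  also have "\<dots> \<le> ?rhs"
    using JF by (intro nn_integral_mono) (auto simp: indicator_def)
  finally show ?thesis .
qed simp

text \<open>Sum the estimates over all levels. If the right-hand side \<open>m\<close> is finite, Young's inequality with
  \<open>\<epsilon> = 1\<close> makes \<open>F\<close> finite, so the levels exhaust the set \<open>{F > 0}\<close>, and \<open>\<Phi>\<^sub>1(0) = 0\<close> disposes of the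
  rest.\<close>
lemma modular_bound_of_weak_bound:
  assumes "0 < q" and yd: "young_density \<phi>2" and mono1: "mono \<Phi>1" and zero: "\<Phi>1 0 = 0"
    and \<beta>: "\<beta> = hardy_beta q \<gamma> (complementary \<phi>2)"
    and BK: "\<exists>C>0. \<forall>t>0.
        (\<integral>\<^sup>+ s \<in> {0<..<t}. \<Phi>1 (\<beta> t / ennreal (C * s powr (1 / q))) * ennreal (s powr \<gamma>) \<partial>lebesgue)
          \<le> \<beta> t \<and> \<beta> t < \<infinity>"
  shows "hardy_modular_bound q \<gamma> \<Phi>1 (young \<phi>2)"
proof -
  obtain C where C: "0 < C" and weak: "\<And>t. 0 < t \<Longrightarrow>
        (\<integral>\<^sup>+ s \<in> {0<..<t}. \<Phi>1 (\<beta> t / ennreal (C * s powr (1 / q))) * ennreal (s powr \<gamma>) \<partial>lebesgue) \<le> \<beta> t"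
      and fin: "\<And>t. 0 < t \<Longrightarrow> \<beta> t < \<infinity>"
    using BK by blast
  note [measurable] = mono_borel_measurable_ennreal[OF mono1] mono_borel_measurable_ennreal[OF mono_young, of \<phi>2]
  have "modular \<Phi>1 \<gamma> (hardy_nonneg q (\<lambda>s. ennreal (f0 s))) \<le> modular (young \<phi>2) \<gamma> (\<lambda>s. ennreal (8 * C * \<bar>f0 s\<bar>))"
    if f0: "f0 \<in> half_line_measurable" "\<forall>t>0. 0 \<le> f0 t" for f0
  proof -
    define f where "f = (\<lambda>s. indicator {0<..} s * f0 s)"
    have f [measurable]: "f \<in> borel_measurable lebesgue"
      unfolding f_def by (rule half_line_measurable_extend[OF f0(1)])
    have fnn: "0 \<le> f s" for s using f0 by (auto simp: f_def indicator_def)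
    define F where "F = tail_integral (\<lambda>s. ennreal (f s) * ennreal (s powr (1 / q - 1)))"
    define m where "m = modular (young \<phi>2) \<gamma> (\<lambda>s. ennreal (8 * C * f s))"
    have m: "modular (young \<phi>2) \<gamma> (\<lambda>s. ennreal (8 * C * \<bar>f0 s\<bar>)) = m"
      unfolding m_def using f0 by (intro modular_cong) (simp add: f_def)
    have Q: "hardy_nonneg q (\<lambda>s. ennreal (f0 s)) t = ennreal (t powr (- (1 / q))) * F t" if "0 < t" for t
    proof -
      have "hardy_nonneg q (\<lambda>s. ennreal (f0 s)) t = hardy_nonneg q (\<lambda>s. ennreal (f s)) t"
        using that by (intro hardy_nonneg_cong) (simp add: f_def)
      then show ?thesis by (simp add: hardy_nonneg_tail F_def)
    qed
    have [measurable]: "F \<in> borel_measurable lebesgue"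
      unfolding F_def by (rule borel_imp_lebesgue_measurable) measurable
    have "modular \<Phi>1 \<gamma> (\<lambda>t. ennreal (t powr (- (1 / q))) * F t) \<le> m" if "m < \<infinity>"
    proof -
      have Ffin: "F t < \<infinity>" if t: "0 < t" for t
      proof -
        have "ennreal (8 * C * 1) * F t \<le>
          (\<integral>\<^sup>+ s \<in> {t<..}. young \<phi>2 (ennreal (8 * C * f s)) * ennreal (s powr \<gamma>) \<partial>lebesgue)
            + scaled_beta q \<gamma> (complementary \<phi>2) 1 t"
          unfolding F_def tail_integral_def using C t by (intro tail_young[OF yd f fnn]) auto
        also have "\<dots> \<le> m + \<beta> t"
          unfolding scaled_beta_1 \<beta> m_def modular_def using t
          by (intro add_right_mono nn_integral_mono) (auto simp: indicator_def)
        also have "\<dots> < \<infinity>" using \<open>m < \<infinity>\<close> fin[OF t] by simp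
        finally show ?thesis using C by (auto simp: ennreal_mult_less_top)
      qed
      let ?g = "\<lambda>x. \<Phi>1 (ennreal (x powr (- (1 / q))) * F x) * ennreal (x powr \<gamma>)"
      let ?h = "\<lambda>s. young \<phi>2 (ennreal (8 * C * f s)) * ennreal (s powr \<gamma>)"
      have g: "?g \<in> borel_measurable lebesgue" and h: "?h \<in> borel_measurable lebesgue" by measurable
      define D where "D n = dyadic_level F (int_decode n)" for n
      define E where "E n = dyadic_level F (int_decode n - 1)" for n
      have level: "dyadic_level F k \<in> sets lebesgue" for k
      proof -
        have "dyadic_level F k = {0<..} \<inter> (F -` {ennreal (2 powr real_of_int k)<..} \<inter> space lebesgue)
            \<inter> (F -` {..ennreal (2 powr (real_of_int k + 1))} \<inter> space lebesgue)"
          by (auto simp: dyadic_level_def)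
        also have "\<dots> \<in> sets lebesgue" by (intro sets.Int measurable_sets[of F _ borel]) simp_all
        finally show ?thesis .
      qed
      have disj: "disjoint_family D" "disjoint_family E"
        unfolding disjoint_family_on_def D_def E_def
        by (intro conjI ballI impI dyadic_level_disjoint; simp add: int_decode_eq)+
      have "modular \<Phi>1 \<gamma> (\<lambda>t. ennreal (t powr (- (1 / q))) * F t) = (\<integral>\<^sup>+ x \<in> (\<Union>n. D n). ?g x \<partial>lebesgue)"
        unfolding modular_def
      proof (rule nn_integral_cong)
        fix x
        have "?g x = 0" if "F x = 0" using that zero by simp
        moreover have "x \<in> (\<Union>n. D n)" if x: "0 < x" "F x \<noteq> 0"
        proof -
          obtain k where "x \<in> dyadic_level F k"
            using dyadic_level_exists[of "F x"] x Ffin[of x] by (auto simp: dyadic_level_def zero_less_iff_neq_zero)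
          then show ?thesis using surj_int_decode by (metis D_def UN_I UNIV_I surjD)
        qed
        moreover have "0 < x" if "x \<in> (\<Union>n. D n)" using that by (auto simp: D_def dyadic_level_def)
        ultimately show "?g x * indicator {0<..} x = ?g x * indicator (\<Union>n. D n) x"
          by (cases "F x = 0") (auto simp: indicator_def)
      qed
      also have "\<dots> = (\<Sum>n. \<integral>\<^sup>+ x \<in> D n. ?g x \<partial>lebesgue)"
        by (rule nn_integral_disjoint_family[OF g _ disj(1)]) (simp add: D_def level)
      also have "\<dots> \<le> (\<Sum>n. \<integral>\<^sup>+ x \<in> E n. ?h x \<partial>lebesgue)"
        unfolding D_def E_def
        by (intro suminf_le[OF _ summableI summableI]
            modular_bound_on_level[OF \<open>0 < q\<close> yd mono1 zero C fin[unfolded \<beta>] weak[unfolded \<beta>] f fnn F_def Ffin])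
      also have "\<dots> = (\<integral>\<^sup>+ x \<in> (\<Union>n. E n). ?h x \<partial>lebesgue)"
        by (rule nn_integral_disjoint_family[OF h _ disj(2), symmetric]) (simp add: E_def level)
      also have "\<dots> \<le> m"
        unfolding m_def modular_def
        by (intro nn_integral_mono) (auto simp: indicator_def E_def dyadic_level_def)
      finally show ?thesis .
    qed
    moreover have "modular \<Phi>1 \<gamma> (hardy_nonneg q (\<lambda>s. ennreal (f0 s)))
        = modular \<Phi>1 \<gamma> (\<lambda>t. ennreal (t powr (- (1 / q))) * F t)"
      by (rule modular_cong) (rule Q)
    ultimately show ?thesis unfolding m by (cases "m = top") (auto simp: less_top)
  qed
  then show ?thesis
    unfolding hardy_modular_bound_def using C by (intro exI[of _ "8 * C"]) auto
qed

theorem corollary4p0p1: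
  fixes q \<gamma> :: real
    and \<phi>1 \<phi>2 :: "real \<Rightarrow> real"
    and \<Phi>1 \<Phi>2 \<Psi>1 \<Psi>2 :: "ennreal \<Rightarrow> ennreal"
    and \<beta> :: "real \<Rightarrow> ennreal"
  assumes "0 < q" and "\<gamma> \<noteq> -1"
    and "young_density \<phi>1" and "young_density \<phi>2"
    and "\<Phi>1 = young \<phi>1" and "\<Phi>2 = young \<phi>2"
    and "\<Psi>1 = complementary \<phi>1" and "\<Psi>2 = complementary \<phi>2"
    and "\<beta> = hardy_beta q \<gamma> \<Psi>2"
  defines "G \<equiv>
      \<exists>L>0. \<forall>f\<in>half_line_measurable. (\<forall>t>0. 0 \<le> f t) \<longrightarrow>
        gauge_norm \<Phi>1 \<gamma> (hardy_nonneg q (\<lambda>s. ennreal (f s)))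
          \<le> ennreal L * gauge_norm \<Phi>2 \<gamma> (\<lambda>s. ennreal (f s))"
    and "M \<equiv>
      \<exists>K>0. \<forall>f\<in>half_line_measurable. (\<forall>t>0. 0 \<le> f t) \<longrightarrow>
        (\<integral>\<^sup>+ t \<in> {0<..}. \<Phi>1 (hardy_nonneg q (\<lambda>s. ennreal (f s)) t) * ennreal (t powr \<gamma>) \<partial>lebesgue)
          \<le> (\<integral>\<^sup>+ s \<in> {0<..}. \<Phi>2 (ennreal (K * \<bar>f s\<bar>)) * ennreal (s powr \<gamma>) \<partial>lebesgue)"
    and "I \<equiv>
      (\<forall>f\<in>orlicz_class \<Phi>2 \<gamma>. hardy_defined q f \<and> hardy_Q q f \<in> orlicz_class \<Phi>1 \<gamma>) \<and>
      orlicz_continuous \<Phi>2 \<Phi>1 \<gamma> (hardy_Q q)"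
    and "BK \<equiv>
      \<exists>C>0. \<forall>t>0.
        (\<integral>\<^sup>+ s \<in> {0<..<t}. \<Phi>1 (\<beta> t / ennreal (C * s powr (1 / q))) * ennreal (s powr \<gamma>) \<partial>lebesgue)
          \<le> \<beta> t \<and> \<beta> t < \<infinity>"
    and "BK' \<equiv>
      \<exists>C>0. \<forall>t>0. \<beta> t < \<infinity> \<and>
        (\<integral>\<^sup>+ s \<in> {0<..<t}. ennreal (\<phi>1 (enn2real (\<beta> t) / (C * s powr (1 / q)))
            * s powr (\<gamma> - 1 / q)) \<partial>lebesgue) \<le> ennreal C"
  shows "(G \<longleftrightarrow> M) \<and> (M \<longleftrightarrow> I) \<and> (I \<longleftrightarrow> BK) \<and> (BK \<longleftrightarrow> BK')"
proof -
  have mono1: "mono \<Phi>1" and mono2: "mono \<Phi>2" and zero1: "\<Phi>1 0 = 0" and zero2: "\<Phi>2 0 = 0"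
    and top1: "\<Phi>1 top = top"
    using assms(3-6) by (simp_all add: mono_young young_top)
  have \<beta>: "\<beta> = hardy_beta q \<gamma> (complementary \<phi>2)" using assms(8,9) by simp
  have G: "G \<longleftrightarrow> hardy_gauge_bound q \<gamma> \<Phi>1 \<Phi>2"
    unfolding G_def hardy_gauge_bound_def ..
  have M: "M \<longleftrightarrow> hardy_modular_bound q \<gamma> \<Phi>1 \<Phi>2"
    unfolding M_def hardy_modular_bound_def modular_def ..
  have "G \<Longrightarrow> M"
    unfolding G M by (rule modular_bound_of_gauge_bound[OF mono1 mono2 \<open>\<gamma> \<noteq> -1\<close>])
  moreover have "M \<Longrightarrow> G"
    unfolding G M by (rule gauge_bound_of_modular_bound)
  moreover have "M \<Longrightarrow> I"
    unfolding M I_def by (rule orlicz_continuous_of_modular_bound[of \<Phi>1, OF mono1 top1])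
  moreover have "I \<Longrightarrow> G"
    unfolding G I_def
    by (elim conjE) (rule gauge_bound_of_orlicz_continuous[of \<Phi>1 \<Phi>2, OF mono1 zero2])
  moreover have "M \<Longrightarrow> BK"
    unfolding M BK_def \<open>\<Phi>1 = young \<phi>1\<close> \<open>\<Phi>2 = young \<phi>2\<close>
    by (rule weak_bound_of_modular_bound[OF assms(3,4,1) _ \<beta>])
  moreover have "BK \<Longrightarrow> M"
    unfolding M BK_def \<open>\<Phi>2 = young \<phi>2\<close>
    by (rule modular_bound_of_weak_bound[OF assms(1,4) mono1 zero1 \<beta>])
  moreover have "BK \<longleftrightarrow> BK'"
    unfolding BK_def BK'_def \<open>\<Phi>1 = young \<phi>1\<close>
    by (rule weak_bound_iff_density_bound[OF assms(3)]) (simp add: \<beta> hardy_beta_pos[OF assms(4)])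
  ultimately show ?thesis by blast
qed

end
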